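(* Let $F_1\colon \mathbb{N}\to\mathbb{C}$ be a bounded function, and let $F_2\colon\mathbb{R}\to\mathbb{C}$ be continuous with compact support. For $N\ge 3$ and $n\in\mathbb{N}$ put $\psi(n)=\frac{\Omega(n) - \log \log N }{\sqrt{\log \log N}}$. Then for any bounded arithmetic function $a\colon \mathbb{N}\to\mathbb{C}$, \[ \frac1N\sum_{n=1}^N F_1(P^+(n))F_2(\psi(n))a(\Omega(n)+1)=\frac1N\sum_{n=1}^N F_1(P^+(n))F_2(\psi(n))a(\Omega(n))+o(1)\quad\text{as } N\to\infty. \]
   Context: $\Omega(n)$ is the number of prime factors of $n$ counted with multiplicity (so $\Omega(1)=0$; for the term $n=1$, $a(0)$ is interpreted with $a$ extended boundedly to $0$). $P^+(n)$ is the largest prime factor of $n$ for $n\ge2$, and $P^+(1)=1$. *)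

theory Defs
  imports
    "HOL-Analysis.Analysis"
    "HOL-Computational_Algebra.Primes"
    "HOL-Library.Landau_Symbols"
begin

definition num_prime_factors :: "nat \<Rightarrow> nat" where
  "num_prime_factors n = size (prime_factorization n)"

(* P^+(n), with the convention P^+(1) = 1; the value at n = 0 is irrelevant. *)
definition largest_prime_factor :: "nat \<Rightarrow> nat" where
  "largest_prime_factor n = (if n \<le> 1 then 1 else Max (prime_factors n))"

(* Meaningful for N \<ge> 3, where ln (ln N) > 0. *)
definition psi :: "nat \<Rightarrow> nat \<Rightarrow> real" where
  "psi N n = (real (num_prime_factors n) - ln (ln (real N))) / sqrt (ln (ln (real N)))"

end

theory Submission
  imports Defs
    "HOL-Number_Theory.Prime_Powers"
    "HOL-Computational_Algebra.Squarefree"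
    "HOL-Real_Asymp.Real_Asymp"
begin

text \<open>
  Put $f_k(n) = F_1(P^+(n))\, F_2(\psi(n))\, a(\Omega(n) + k)$ and
  $H_k(v) = \frac{e^v}{N} \sum_{n \le N e^{-v}} f_k(n)$. For a fixed prime $p$, $f_k(pn)$ and
  $f_{k+1}(n)$ agree up to $o(1)$ on average, so the Turan--Kubilius inequality shows that
  $H_k(v)$ is nearly the average of $H_{k+1}(v + \log p)$ over any finite set of primes with large
  reciprocal sum. In the limit along a suitable filter one obtains bounded Lipschitz functions
  $H_k$ that satisfy this averaging property for all $v$.

  Such functions do not depend on $v$. If an increment $H_k(v + h) - H_k(v)$ is almost extremal, then
  so are the increments of $H_{k+1}$ at $v + \log p$ for most primes $p$. If many pairs of primes
  have logarithmic difference close to $h$, this yields long chains of almost extremal increments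
  at the points $v' + jh$; their sum is unbounded unless all increments vanish, so every $H_k$ is
  $h$-periodic. Arbitrarily small such $h$ exist: otherwise the primes would cluster in
  logarithmically short intervals, against the upper bound for primes in short intervals that
  follows from Selberg's formula. Finally, averaging constants gives $H_{k+1} = H_k$.
\<close>

section \<open>Selberg's formula\<close>

text \<open>The levels k exist because passing from n to pn changes the argument of
  \<open>a\<close>: level k is compared with level k + 1, and moreover at another scale, so neither
  kind of invariance is available alone. The obstruction is a family like z^k e^(itv) with z of
  modulus 1: it satisfies the averaging property as soon as p^(it) is close to 1/z for almost all
  primes, counted with weight 1/p. Ruling this out means showing that the numbers log p do not
  cluster near an arithmetic progression, which divergence of the sum of 1/p alone does not give. An
  upper bound for primes in short intervals with any fixed constant factor is enough, since it need
  only beat a lower bound of Mertens strength; hence Selberg's formula, used one-sidedly, replaces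
  the prime number theorem. The averages carry an error of the order of the square root of the total
  weight W of the primes. They therefore control only almost all primes, and only when W is large;
  this is why the gaps h have to survive the deletion of a small proportion of the primes.\<close>

definition moebius :: "nat \<Rightarrow> real" where
  "moebius n = (if squarefree n then (-1) ^ card (prime_factors n) else 0)"

lemma abs_moebius_le_1: "\<bar>moebius n\<bar> \<le> 1"
  by (simp add: moebius_def)

lemma squarefree_mult_prime_iff:
  fixes p d :: nat
  assumes "prime p" "\<not> p dvd d"
  shows "squarefree (p * d) \<longleftrightarrow> squarefree d"
proof -
  have "coprime p d" using assms by (simp add: prime_imp_coprime)
  moreover have "squarefree p" using assms(1) by (simp add: squarefree_prime)
  ultimately show ?thesis by (blast intro: squarefree_mult_coprime dest: squarefree_multD)
qed

lemma moebius_prime_mult: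
  assumes "prime p" "\<not> p dvd d"
  shows "moebius (p * d) = - moebius d"
proof -
  have d: "d \<noteq> 0" using assms(2) by (intro notI) simp
  have "prime_factors (p * d) = insert p (prime_factors d)"
    using assms(1) d by (auto simp: prime_factors_product prime_prime_factors)
  moreover have "p \<notin> prime_factors d" using assms by auto
  ultimately show ?thesis
    by (simp add: moebius_def squarefree_mult_prime_iff[OF assms])
qed

text \<open>Cancellation in pairs: for a prime p dividing n, multiplication by p maps the squarefree
  divisors prime to p onto those divisible by p and flips the sign.\<close>

lemma sum_moebius_divisors:
  assumes "n > 0"
  shows "(\<Sum>d | d dvd n. moebius d) = (if n = 1 then 1 else 0)"
proof (cases "n = 1")
  case False
  then obtain p where p: "prime p" "p dvd n" using prime_factor_nat by blast
  define A where "A = {d. d dvd n \<and> squarefree d \<and> \<not> p dvd d}"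
  define B where "B = {d. d dvd n \<and> squarefree d \<and> p dvd d}"
  have fin: "finite {d. d dvd n}" using assms by simp
  then have finAB: "finite A" "finite B" by (auto simp: A_def B_def)
  have B: "B = (*) p ` A"
  proof (intro equalityI subsetI)
    fix d assume "d \<in> B"
    then have d: "d dvd n" "squarefree d" "p dvd d" by (auto simp: B_def)
    then obtain e where e: "d = p * e" by blast
    have "\<not> p dvd e"
      using d(2) p(1) e by (metis mult_dvd_mono dvd_refl not_prime_unit power2_eq_square squarefreeD)
    then have "e \<in> A"
      using d e p squarefree_mult_prime_iff by (auto simp: A_def dest: dvd_mult_right)
    then show "d \<in> (*) p ` A" using e by auto
  next
    fix d assume "d \<in> (*) p ` A"
    then obtain e where e: "d = p * e" "e dvd n" "squarefree e" "\<not> p dvd e" by (auto simp: A_def)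
    have "p * e dvd n"
      using e p by (intro divides_mult) (auto simp: prime_imp_coprime)
    then show "d \<in> B"
      using e p squarefree_mult_prime_iff by (auto simp: B_def)
  qed
  have inj: "inj_on ((*) p) A" using p(1) by (auto simp: inj_on_def)
  have "(\<Sum>d | d dvd n. moebius d) = (\<Sum>d\<in>A \<union> B. moebius d)"
    using fin by (intro sum.mono_neutral_right) (auto simp: A_def B_def moebius_def)
  also have "\<dots> = (\<Sum>d\<in>A. moebius d) + (\<Sum>d\<in>B. moebius d)"
    using finAB by (intro sum.union_disjoint) (auto simp: A_def B_def)
  also have "(\<Sum>d\<in>B. moebius d) = (\<Sum>d\<in>A. moebius (p * d))"
    unfolding B using inj by (simp add: sum.reindex)
  also have "\<dots> = (\<Sum>d\<in>A. - moebius d)"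
    using p by (intro sum.cong) (auto simp: A_def moebius_prime_mult)
  finally show ?thesis using False by (simp add: sum_negf)
qed (simp add: moebius_def)

lemma sum_divisors_eq_sum_pairs:
  fixes g :: "nat \<Rightarrow> nat \<Rightarrow> 'a :: comm_monoid_add"
  shows "(\<Sum>n=1..N. \<Sum>d | d dvd n. g d (n div d)) = (\<Sum>d=1..N. \<Sum>m=1..N div d. g d m)"
proof -
  have "(\<Sum>n=1..N. \<Sum>d | d dvd n. g d (n div d)) =
      (\<Sum>(n, d)\<in>(SIGMA n:{1..N}. {d. d dvd n}). g d (n div d))"
    by (rule sum.Sigma) auto
  also have "\<dots> = (\<Sum>(d, m)\<in>(SIGMA d:{1..N}. {1..N div d}). g d m)"
  proof (rule sum.reindex_bij_witness[of _ "\<lambda>(d, m). (d * m, d)" "\<lambda>(n, d). (d, n div d)"])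
    fix x assume "x \<in> (SIGMA d:{1..N}. {1..N div d})"
    then obtain d m where x: "x = (d, m)" "1 \<le> d" "1 \<le> m" "m \<le> N div d" by auto
    then have "d * m \<le> N"
      by (metis div_times_less_eq_dividend le_trans mult.commute mult_le_mono2)
    then show "(case x of (d, m) \<Rightarrow> (d * m, d)) \<in> (SIGMA n:{1..N}. {d. d dvd n})"
      using x by auto
    show "(\<lambda>(n, d). (d, n div d)) (case x of (d, m) \<Rightarrow> (d * m, d)) = x"
      using x by auto
  next
    fix x assume "x \<in> (SIGMA n:{1..N}. {d. d dvd n})"
    then obtain n d where x: "x = (n, d)" "1 \<le> n" "n \<le> N" "d dvd n" by auto
    then have d: "d \<ge> 1" "d \<le> n"
      by (auto simp: dvd_imp_le Suc_le_eq intro: Nat.gr0I)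
    then have "n div d \<ge> 1" using div_greater_zero_iff[of n d] by linarith
    moreover have "n div d \<le> N div d" using x by (simp add: div_le_mono)
    ultimately show "(case x of (n, d) \<Rightarrow> (d, n div d)) \<in> (SIGMA d:{1..N}. {1..N div d})"
      using x d by auto
    show "(case (case x of (n, d) \<Rightarrow> (d, n div d)) of (d, m) \<Rightarrow> (d * m, d)) = x"
      using x by auto
  qed auto
  also have "\<dots> = (\<Sum>d=1..N. \<Sum>m=1..N div d. g d m)"
    by (rule sum.Sigma[symmetric]) auto
  finally show ?thesis .
qed

lemma sum_divisors_inverse:
  fixes g :: "nat \<Rightarrow> nat \<Rightarrow> 'a :: comm_monoid_add"
  assumes "n > 0"
  shows "(\<Sum>d | d dvd n. g d (n div d)) = (\<Sum>d | d dvd n. g (n div d) d)"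
  by (rule sum.reindex_bij_witness[of _ "\<lambda>d. n div d" "\<lambda>d. n div d"])
     (use assms in \<open>auto elim!: dvdE\<close>)

text \<open>Moebius inversion of \<open>mangoldt_sum\<close>: expanding each logarithm and
  exchanging the two divisors leaves an inner sum of \<open>moebius\<close> that survives only at e
  = n.\<close>

lemma sum_moebius_ln_divisors:
  assumes "n > 0"
  shows "(\<Sum>d | d dvd n. moebius d * ln (real (n div d))) = mangoldt n"
proof -
  have fin: "finite {d. d dvd n}" using assms by simp
  have "(\<Sum>d | d dvd n. moebius d * ln (real (n div d))) =
      (\<Sum>d | d dvd n. \<Sum>e | e dvd n div d. moebius d * mangoldt e)"
  proof (intro sum.cong refl)
    fix d assume "d \<in> {d. d dvd n}"
    then have "n div d \<noteq> 0" using assms by (auto elim!: dvdE)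
    from mangoldt_sum[OF this, where ?'a = real]
    show "moebius d * ln (real (n div d)) = (\<Sum>e | e dvd n div d. moebius d * mangoldt e)"
      unfolding sum_distrib_left[symmetric] by simp
  qed
  also have "\<dots> = (\<Sum>(d, e)\<in>(SIGMA d:{d. d dvd n}. {e. e dvd n div d}). moebius d * mangoldt e)"
    using assms by (intro sum.Sigma) (auto elim!: dvdE)
  also have "\<dots> = (\<Sum>(e, d)\<in>(SIGMA e:{e. e dvd n}. {d. d dvd n div e}). moebius d * mangoldt e)"
  proof -
    have *: "e dvd n \<and> d dvd n div e" if dn: "d dvd n" and en: "e dvd n div d" for d e :: nat
    proof -
      have "d > 0" using dn assms by (intro Nat.gr0I) auto
      moreover obtain k where "n = d * k" using dn by blast
      moreover from this \<open>d > 0\<close> obtain m where "k = e * m" using en by auto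
      ultimately show ?thesis using assms by auto
    qed
    show ?thesis
      by (rule sum.reindex_bij_witness[of _ "\<lambda>(e, d). (d, e)" "\<lambda>(d, e). (e, d)"])
         (auto dest: *)
  qed
  also have "\<dots> = (\<Sum>e | e dvd n. \<Sum>d | d dvd n div e. moebius d * mangoldt e)"
    using assms by (intro sum.Sigma[symmetric]) (auto elim!: dvdE)
  also have "\<dots> = (\<Sum>e | e dvd n. mangoldt e * (if n div e = 1 then 1 else 0))"
  proof (intro sum.cong refl)
    fix e assume "e \<in> {d. d dvd n}"
    then have "n div e > 0" using assms by (auto elim!: dvdE)
    from sum_moebius_divisors[OF this]
    show "(\<Sum>d | d dvd n div e. moebius d * mangoldt e) = mangoldt e * (if n div e = 1 then 1 else 0)"
      unfolding sum_distrib_right[symmetric] by simp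
  qed
  also have "\<dots> = (\<Sum>e\<in>{n}. mangoldt e * (if n div e = 1 then 1 else 0))"
    using assms fin by (intro sum.mono_neutral_right) (auto elim!: dvdE)
  finally show ?thesis using assms by simp
qed

text \<open>Selberg's weight splits as ln (N/d) = ln (N/n) + ln (n/d). The first part is constant in
  d and survives only at n = 1; the second is the inversion giving \<open>mangoldt\<close>.\<close>

lemma sum_moebius_ln_div_divisors:
  assumes "n > 0" "N > 0"
  shows "(\<Sum>d | d dvd n. moebius d * ln (real N / real d)) =
    (if n = 1 then ln (real N) else 0) + mangoldt n"
proof -
  have "(\<Sum>d | d dvd n. moebius d * ln (real N / real d)) =
      (\<Sum>d | d dvd n. moebius d * ln (real N / real n) + moebius d * ln (real (n div d)))"
  proof (intro sum.cong refl)
    fix d assume "d \<in> {d. d dvd n}"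
    then have "d dvd n" "d > 0" using assms by (auto intro!: Nat.gr0I)
    then have "ln (real N / real d) = ln (real N / real n) + ln (real (n div d))"
      using assms by (simp add: real_of_nat_div ln_div)
    then show "moebius d * ln (real N / real d) =
        moebius d * ln (real N / real n) + moebius d * ln (real (n div d))"
      by (simp add: algebra_simps)
  qed
  also have "\<dots> = (\<Sum>d | d dvd n. moebius d) * ln (real N / real n) + mangoldt n"
    by (simp add: sum.distrib sum_distrib_right sum_moebius_ln_divisors[OF assms(1)])
  finally show ?thesis using assms by (simp add: sum_moebius_divisors)
qed

section \<open>Chebyshev and Mertens bounds\<close>

definition chebyshev_psi :: "nat \<Rightarrow> real" where
  "chebyshev_psi n = (\<Sum>i=1..n. mangoldt i)"

lemma chebyshev_psi_mono: "m \<le> n \<Longrightarrow> chebyshev_psi m \<le> chebyshev_psi n"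
  unfolding chebyshev_psi_def by (intro sum_mono2) (auto simp: mangoldt_nonneg)

lemma chebyshev_psi_nonneg: "chebyshev_psi n \<ge> 0"
  unfolding chebyshev_psi_def by (intro sum_nonneg) (auto simp: mangoldt_nonneg)

lemma ln_fact_eq_sum_ln: "ln (fact n :: real) = (\<Sum>k=1..n. ln (real k))"
  by (induction n) (simp_all add: ln_mult)

lemma ln_fact_eq_sum_chebyshev_psi: "ln (fact n :: real) = (\<Sum>m=1..n. chebyshev_psi (n div m))"
proof -
  have "ln (fact n :: real) = (\<Sum>k=1..n. \<Sum>d | d dvd k. mangoldt d)"
    unfolding ln_fact_eq_sum_ln by (intro sum.cong refl) (subst mangoldt_sum, auto)
  also have "\<dots> = (\<Sum>k=1..n. \<Sum>d | d dvd k. mangoldt (k div d))"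
    by (intro sum.cong refl sum_divisors_inverse[of _ "\<lambda>a b. mangoldt a"]) auto
  also have "\<dots> = (\<Sum>m=1..n. \<Sum>d=1..n div m. mangoldt d)"
    by (rule sum_divisors_eq_sum_pairs)
  finally show ?thesis by (simp add: chebyshev_psi_def)
qed

lemma ln_fact_eq_sum_mangoldt: "ln (fact n :: real) = (\<Sum>d=1..n. mangoldt d * real (n div d))"
proof -
  have "ln (fact n :: real) = (\<Sum>k=1..n. \<Sum>d | d dvd k. mangoldt d)"
    unfolding ln_fact_eq_sum_ln by (intro sum.cong refl) (subst mangoldt_sum, auto)
  also have "\<dots> = (\<Sum>d=1..n. \<Sum>m=1..n div d. mangoldt d)"
    by (rule sum_divisors_eq_sum_pairs)
  finally show ?thesis by (simp add: mult.commute)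
qed

lemma ln_Suc_minus_ln:
  assumes "n > 0"
  shows "ln (real (Suc n)) - ln (real n) \<le> 1 / real n"
    and "ln (real (Suc n)) - ln (real n) \<ge> 1 / real (Suc n)"
proof -
  show "ln (real (Suc n)) - ln (real n) \<le> 1 / real n"
    using ln_diff_le_inverse[of "real n"] assms by (simp add: add.commute)
  have "ln (real n / real (Suc n)) \<le> real n / real (Suc n) - 1"
    using assms by (intro ln_le_minus_one) auto
  then show "ln (real (Suc n)) - ln (real n) \<ge> 1 / real (Suc n)"
    using assms by (simp add: ln_div field_simps)
qed

lemma ln_fact_ge: "ln (fact n :: real) \<ge> real n * ln (real n) - real n"
proof (induction n)
  case (Suc n)
  show ?case
  proof (cases "n = 0")
    case False
    then have "real n * (ln (real (Suc n)) - ln (real n)) \<le> 1"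
      using ln_Suc_minus_ln(1)[of n] by (simp add: field_simps)
    moreover have "ln (fact (Suc n) :: real) = ln (real (Suc n)) + ln (fact n)"
      by (subst fact_Suc, subst ln_mult) simp_all
    ultimately show ?thesis using Suc by (simp add: algebra_simps del: fact_Suc)
  qed auto
qed auto

lemma ln_fact_le: "n > 0 \<Longrightarrow> ln (fact n :: real) \<le> real n * ln (real n) - real n + 1 + ln (real n)"
proof (induction n rule: nat_induct_non_zero)
  case (Suc n)
  then have "real (Suc n) * (ln (real (Suc n)) - ln (real n)) \<ge> 1"
    using ln_Suc_minus_ln(2)[of n] by (simp add: field_simps)
  moreover have "ln (fact (Suc n) :: real) = ln (real (Suc n)) + ln (fact n)"
    by (subst fact_Suc, subst ln_mult) simp_all
  ultimately show ?case using Suc by (simp add: algebra_simps del: fact_Suc)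
qed auto

text \<open>Legendre's formula for n! / (M!)^2 with M = n div 2: the coefficient floor(n/i) - 2
  floor(M/i) is never negative and at least 1 on (M, n]. The quotient is a binomial coefficient, at
  most 2^n, up to a factor of at most n when n is odd.\<close>

lemma chebyshev_psi_dyadic_le: "chebyshev_psi n - chebyshev_psi (n div 2) \<le> 2 * real n"
proof (cases "n = 0")
  case False
  define M where "M = n div 2"
  have "chebyshev_psi n - chebyshev_psi M = (\<Sum>i=M+1..n. mangoldt i)"
  proof -
    have "{1..n} = {1..M} \<union> {M+1..n}" by (auto simp: M_def)
    then have "chebyshev_psi n = chebyshev_psi M + (\<Sum>i=M+1..n. mangoldt i)"
      unfolding chebyshev_psi_def by (simp add: sum.union_disjoint)
    then show ?thesis by simp
  qed
  also have "\<dots> \<le> (\<Sum>i=M+1..n. mangoldt i * (real (n div i) - 2 * real (M div i)))"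
  proof (intro sum_mono)
    fix i assume i: "i \<in> {M+1..n}"
    then have "n div i \<ge> 1" using div_greater_zero_iff[of n i] by auto
    moreover have "M div i = 0" using i by auto
    ultimately have "real (n div i) - 2 * real (M div i) \<ge> 1" by auto
    then show "mangoldt i \<le> mangoldt i * (real (n div i) - 2 * real (M div i))"
      using mangoldt_nonneg[of i] by (simp add: mult_left_le mult_le_cancel_left1)
  qed
  also have "\<dots> \<le> (\<Sum>i=1..n. mangoldt i * (real (n div i) - 2 * real (M div i)))"
  proof (intro sum_mono2)
    fix i assume "i \<in> {1..n} - {M+1..n}"
    have "2 * (M div i) \<le> n div i"
      unfolding M_def by (metis div_mult2_eq mult.commute times_div_less_eq_dividend)
    then have "real (n div i) - 2 * real (M div i) \<ge> 0" by linarith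
    then show "0 \<le> mangoldt i * (real (n div i) - 2 * real (M div i))"
      using mangoldt_nonneg[of i] by simp
  qed auto
  also have "\<dots> = ln (fact n) - 2 * (\<Sum>i=1..n. mangoldt i * real (M div i))"
    by (simp add: ln_fact_eq_sum_mangoldt algebra_simps sum_subtractf sum_distrib_left)
  also have "(\<Sum>i=1..n. mangoldt i * real (M div i)) = ln (fact M)"
    unfolding ln_fact_eq_sum_mangoldt by (intro sum.mono_neutral_right) (auto simp: M_def)
  finally have 1: "chebyshev_psi n - chebyshev_psi M \<le> ln (fact n) - 2 * ln (fact M)" by simp
  have "fact n = fact M * fact (n - M) * (n choose M)"
    by (rule binomial_fact_lemma[symmetric]) (simp add: M_def)
  then have eq: "(fact n :: real) = fact M * fact (n - M) * real (n choose M)"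
    by (metis of_nat_fact of_nat_mult)
  have "n choose M \<le> 2 ^ n" by (rule binomial_le_pow2)
  then have "real (n choose M) \<le> 2 ^ n" by (metis of_nat_le_iff of_nat_numeral of_nat_power)
  moreover have "(fact (n - M) :: real) \<le> fact M * real n"
  proof -
    have "n - M = M \<or> n - M = Suc M" unfolding M_def by presburger
    moreover have "Suc M \<le> n" if "n - M = Suc M" using that by arith
    ultimately show ?thesis using False
      by (auto simp: mult.commute Suc_le_eq intro!: mult_right_mono)
  qed
  ultimately have "(fact n :: real) \<le> fact M * (fact M * real n) * 2 ^ n"
    unfolding eq by (intro mult_mono mult_nonneg_nonneg) auto
  then have "ln (fact n :: real) \<le> ln (fact M * (fact M * real n) * 2 ^ n)"
    using False by (subst ln_le_cancel_iff) auto
  also have "\<dots> = 2 * ln (fact M) + ln (real n) + real n * ln 2"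
    using False by (simp add: ln_mult ln_realpow)
  also have "ln (real n) \<le> real n" using False ln_bound[of "real n"] by simp
  also have "real n * ln 2 \<le> real n * 1"
    using ln_le_minus_one[of 2] by (intro mult_left_mono) auto
  finally show ?thesis using 1 by (simp add: M_def)
qed (simp add: chebyshev_psi_def)

text \<open>Repeated halving gives the geometric series 2 n + n + n/2 + ..., hence the constant
  4.\<close>

lemma chebyshev_psi_le: "chebyshev_psi n \<le> 4 * real n"
proof (induction n rule: less_induct)
  case (less n)
  show ?case
  proof (cases "n = 0")
    case False
    then have "chebyshev_psi (n div 2) \<le> 4 * real (n div 2)" by (intro less) auto
    moreover have "real (n div 2) \<le> real n / 2" using of_nat_div_le_of_nat[of n 2, where ?'a = real] by simp
    ultimately show ?thesis using chebyshev_psi_dyadic_le[of n] by simp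
  qed (simp add: chebyshev_psi_def)
qed

lemma sum_mangoldt_over_id_ge:
  assumes "n > 0"
  shows "(\<Sum>i=1..n. mangoldt i / real i) \<ge> ln (real n) - 1"
proof -
  have "real n * ln (real n) - real n \<le> (\<Sum>i=1..n. mangoldt i * real (n div i))"
    using ln_fact_ge[of n] by (simp add: ln_fact_eq_sum_mangoldt)
  also have "\<dots> \<le> (\<Sum>i=1..n. mangoldt i * (real n / real i))"
    by (intro sum_mono mult_left_mono of_nat_div_le_of_nat mangoldt_nonneg)
  also have "\<dots> = real n * (\<Sum>i=1..n. mangoldt i / real i)"
    by (simp add: sum_distrib_left field_simps)
  finally have "real n * (ln (real n) - 1) \<le> real n * (\<Sum>i=1..n. mangoldt i / real i)"
    by (simp add: algebra_simps)
  then show ?thesis using assms by simp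
qed

text \<open>Replacing floor(n/i) by n/i - 1 costs one \<open>chebyshev_psi n\<close>, which is the
  source of the 4.\<close>

lemma sum_mangoldt_over_id_le:
  assumes "n > 0"
  shows "(\<Sum>i=1..n. mangoldt i / real i) \<le> ln (real n) + 4"
proof -
  have "real n * (\<Sum>i=1..n. mangoldt i / real i) - chebyshev_psi n =
      (\<Sum>i=1..n. mangoldt i * (real n / real i - 1))"
    unfolding chebyshev_psi_def sum_distrib_left sum_subtractf[symmetric]
    by (intro sum.cong) (auto simp: field_simps)
  also have "\<dots> \<le> (\<Sum>i=1..n. mangoldt i * real (n div i))"
  proof (intro sum_mono mult_left_mono mangoldt_nonneg)
    fix i show "real n / real i - 1 \<le> real (n div i)"
      using real_of_int_div3[of "int n" "int i"] zdiv_int[of n i] by simp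
  qed
  also have "\<dots> \<le> real n * ln (real n) - real n + 1 + ln (real n)"
    using ln_fact_le[OF assms] by (simp add: ln_fact_eq_sum_mangoldt)
  also have "\<dots> \<le> real n * ln (real n)"
    using assms ln_le_minus_one[of "real n"] by simp
  finally have "real n * (\<Sum>i=1..n. mangoldt i / real i) \<le> real n * (ln (real n) + 4)"
    using chebyshev_psi_le[of n] by (simp add: algebra_simps)
  then show ?thesis using assms by simp
qed

section \<open>Harmonic sums and the error terms of Selberg's formula\<close>

lemma harm_minus_ln_bounds:
  assumes "n > 0"
  shows "harm n - ln (real n) - euler_mascheroni \<ge> (0 :: real)"
    and "harm n - ln (real n) - euler_mascheroni \<le> 1 / real n"
proof -
  have "euler_mascheroni \<le> harm n - ln (real n)"
    using euler_mascheroni_LIMSEQ euler_mascheroni_sequence_decreasing[OF assms]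
    by (intro LIMSEQ_le_const2) auto
  then show "harm n - ln (real n) - euler_mascheroni \<ge> 0" by simp
  \<comment> \<open>The companion sequence with ln (m + 1) increases to the same limit, so the Euler
    constant lies between the two.\<close>
  define b where "b m = harm m - ln (real (Suc m))" for m :: nat
  have "b m \<le> b (Suc m)" for m
    using ln_Suc_minus_ln(1)[of "Suc m"] by (simp add: b_def harm_Suc inverse_eq_divide)
  then have "incseq b" by (rule incseq_SucI)
  then have "b n \<le> harm m - ln (real m)" if "m \<ge> n" for m
    using that assms by (intro order_trans[OF incseqD[of b n m]]) (auto simp: b_def)
  then have "b n \<le> euler_mascheroni"
    using euler_mascheroni_LIMSEQ by (intro LIMSEQ_le_const) auto
  then show "harm n - ln (real n) - euler_mascheroni \<le> 1 / real n"
    using ln_Suc_minus_ln(1)[OF assms] by (simp add: b_def)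
qed

lemma euler_mascheroni_0_1: "euler_mascheroni \<ge> (0 :: real)" "euler_mascheroni \<le> (1 :: real)"
  using harm_minus_ln_bounds[of 1] by (simp_all add: harm_def)

text \<open>Applied with y = N/d and M its integer part, where the expression is the divisor sum of
  the function F in Selberg's formula. The main terms M ln M, M and the Euler constant times M
  cancel, which explains the summand \<gamma> + 1 in F.\<close>

lemma abs_ln_fact_minus_harm_le:
  fixes y :: real
  assumes "M > 0" "real M \<le> y" "y \<le> real M + 1"
  shows "\<bar>ln (fact M) - y * harm M + (euler_mascheroni + 1) * real M\<bar> \<le> 2 + ln y"
proof -
  define r1 where "r1 = ln (fact M) - (real M * ln (real M) - real M)"
  define r2 where "r2 = harm M - ln (real M) - euler_mascheroni"
  have r1: "0 \<le> r1" "r1 \<le> 1 + ln (real M)"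
    using ln_fact_ge[of M] ln_fact_le[OF assms(1)] by (auto simp: r1_def)
  have "0 \<le> r2" "r2 \<le> 1 / real M"
    using harm_minus_ln_bounds[OF assms(1)] by (auto simp: r2_def)
  then have r2: "0 \<le> real M * r2" "real M * r2 \<le> 1" "r2 \<le> 1 / real M"
    using assms(1) by (auto simp: field_simps)
  have h: "harm M \<ge> (0 :: real)" by (rule harm_nonneg)
  have "(y - real M) * harm M \<le> 1 * harm M"
    using assms h by (intro mult_right_mono) auto
  moreover have "(y - real M) * harm M \<ge> 0" using assms h by simp
  moreover have "harm M \<le> 1 + ln (real M)"
    using assms(1)
  proof (induction M rule: nat_induct_non_zero)
    case (Suc n)
    then show ?case using ln_Suc_minus_ln(2)[of n] by (simp add: harm_Suc inverse_eq_divide)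
  qed (simp add: harm_def)
  moreover have "ln (fact M) - y * harm M + (euler_mascheroni + 1) * real M =
      r1 - real M * r2 - (y - real M) * harm M"
    by (simp add: r1_def r2_def algebra_simps)
  moreover have "ln (real M) \<le> ln y" "0 \<le> ln (real M)" using assms by auto
  ultimately show ?thesis using r1 r2 unfolding abs_le_iff by linarith
qed

text \<open>Any fixed power y^c with 0 < c < 1 would do on the right, since the sum of (N/d)^c over
  d \<le> N is then O(N). The proof writes ln y = 4 ln (y^(1/4)).\<close>

lemma ln_mult_ln_le_sqrt:
  assumes "y \<ge> (1 :: real)"
  shows "ln y * (2 + ln y) \<le> 16 * sqrt y"
proof -
  define s where "s = sqrt (sqrt y)"
  have s: "s \<ge> 1" "s * s = sqrt y" "sqrt y * sqrt y = y" using assms by (auto simp: s_def)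
  have "ln y = 2 * ln (sqrt y)" using assms by (simp add: ln_sqrt)
  also have "ln (sqrt y) = 2 * ln s" using assms by (simp add: s_def ln_sqrt)
  finally have "ln y = 4 * ln s" by simp
  moreover have "ln s \<le> s - 1" using s by (intro ln_le_minus_one) auto
  ultimately have "ln y \<le> 4 * s" "2 + ln y \<le> 4 * s" by linarith+
  moreover have "ln y \<ge> 0" using assms by simp
  ultimately have "ln y * (2 + ln y) \<le> (4 * s) * (4 * s)" by (intro mult_mono) auto
  then show ?thesis using s by (simp add: algebra_simps)
qed

lemma sum_inverse_sqrt_le: "(\<Sum>d=1..n. 1 / sqrt (real d)) \<le> 2 * sqrt (real n)"
proof (induction n)
  case (Suc n)
  have "1 / sqrt (real (Suc n)) \<le> 2 * (sqrt (real (Suc n)) - sqrt (real n))"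
  proof -
    define a b where "a = sqrt (real (Suc n))" and "b = sqrt (real n)"
    have ab: "a > 0" "b \<ge> 0" "a * a = b * b + 1" by (auto simp: a_def b_def)
    have "(a - b) * (a - b) \<ge> 0" by simp
    with ab have "1 \<le> 2 * (a - b) * a" by (simp add: algebra_simps)
    with ab show ?thesis unfolding a_def[symmetric] b_def[symmetric] by (simp add: divide_le_eq)
  qed
  with Suc show ?case by simp
qed simp

text \<open>The Tatuzawa--Iseki argument: the function $F(x) = \psi(x) - x + \gamma + 1$ has a small
  divisor sum $\sum_{m \le x} F(x/m)$, and Moebius inversion with the weight $\log(x/d)$ turns this
  into Selberg's formula.\<close>

lemma selberg_formula:
  assumes "N > 0"
  shows "\<bar>chebyshev_psi N * ln (real N) + (\<Sum>n=1..N. mangoldt n * chebyshev_psi (N div n)) -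
    2 * real N * ln (real N)\<bar> \<le> 46 * real N"
proof -
  define g where "g = (euler_mascheroni :: real)"
  define F where "F n = chebyshev_psi (N div n) - real N / real n + g + 1" for n
  \<comment> \<open>\<open>F n\<close> is the function F at the argument N/n. T is evaluated twice:
    grouping by n = d * m produces the expression of Selberg's formula, while bounding each inner
    sum gives O(N).\<close>
  define T where "T = (\<Sum>d=1..N. moebius d * ln (real N / real d) * (\<Sum>m=1..N div d. F (d * m)))"
  define L where "L = (\<Sum>n=1..N. mangoldt n / real n)"
  define S where "S = (\<Sum>n=1..N. mangoldt n * chebyshev_psi (N div n))"
  have "T = (\<Sum>d=1..N. \<Sum>m=1..N div d. moebius d * ln (real N / real d) * F (d * m))"
    by (simp add: T_def sum_distrib_left)
  also have "\<dots> = (\<Sum>n=1..N. \<Sum>d | d dvd n. moebius d * ln (real N / real d) * F (d * (n div d)))"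
    by (rule sum_divisors_eq_sum_pairs[symmetric])
  also have "\<dots> = (\<Sum>n=1..N. F n * ((if n = 1 then ln (real N) else 0) + mangoldt n))"
  proof (intro sum.cong refl)
    fix n assume n: "n \<in> {1..N}"
    have "(\<Sum>d | d dvd n. moebius d * ln (real N / real d) * F (d * (n div d))) =
        (\<Sum>d | d dvd n. moebius d * ln (real N / real d)) * F n"
      by (simp add: sum_distrib_right)
    then show "(\<Sum>d | d dvd n. moebius d * ln (real N / real d) * F (d * (n div d))) =
        F n * ((if n = 1 then ln (real N) else 0) + mangoldt n)"
      using n assms by (simp add: sum_moebius_ln_div_divisors)
  qed
  also have "\<dots> = (\<Sum>n=1..N. if n = 1 then F n * ln (real N) else 0) + (\<Sum>n=1..N. F n * mangoldt n)"
    unfolding sum.distrib[symmetric] by (intro sum.cong) (auto simp: algebra_simps)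
  also have "(\<Sum>n=1..N. if n = 1 then F n * ln (real N) else 0) = F 1 * ln (real N)"
    using assms by simp
  also have "(\<Sum>n=1..N. F n * mangoldt n) =
      (\<Sum>n=1..N. mangoldt n * chebyshev_psi (N div n) - real N * (mangoldt n / real n) + (g + 1) * mangoldt n)"
    by (intro sum.cong) (auto simp: F_def algebra_simps)
  also have "\<dots> = S - real N * L + (g + 1) * chebyshev_psi N"
    unfolding S_def L_def chebyshev_psi_def by (simp only: sum.distrib sum_subtractf sum_distrib_left)
  finally have T: "T = F 1 * ln (real N) + (S - real N * L + (g + 1) * chebyshev_psi N)" .
  have "\<bar>T\<bar> \<le> (\<Sum>d=1..N. \<bar>moebius d * ln (real N / real d) * (\<Sum>m=1..N div d. F (d * m))\<bar>)"
    unfolding T_def by (rule sum_abs)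
  also have "\<dots> \<le> (\<Sum>d=1..N. 16 * sqrt (real N / real d))"
  proof (intro sum_mono)
    fix d assume d: "d \<in> {1..N}"
    define M where "M = N div d"
    define y where "y = real N / real d"
    have M: "M > 0" using d by (auto simp: M_def div_greater_zero_iff)
    have yM: "real M \<le> y" unfolding M_def y_def by (rule of_nat_div_le_of_nat)
    have "y \<le> real M + 1" 
      using real_of_int_div3[of "int N" "int d"] zdiv_int[of N d] by (simp add: y_def M_def)
    note * = abs_ln_fact_minus_harm_le[OF M yM this]
    have y: "y \<ge> 1" using yM M by linarith
    have "(\<Sum>m=1..M. F (d * m)) =
        (\<Sum>m=1..M. chebyshev_psi (M div m) - y * inverse (real m) + (g + 1))"
      by (intro sum.cong) (auto simp: F_def M_def y_def div_mult2_eq[symmetric] field_simps)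
    also have "\<dots> = ln (fact M) - y * harm M + (g + 1) * real M"
      by (simp add: sum.distrib sum_subtractf sum_distrib_left ln_fact_eq_sum_chebyshev_psi harm_def)
    finally have "\<bar>\<Sum>m=1..M. F (d * m)\<bar> \<le> 2 + ln y" using * by (simp add: g_def)
    then have "\<bar>moebius d * ln y * (\<Sum>m=1..M. F (d * m))\<bar> \<le> 1 * ln y * (2 + ln y)"
      unfolding abs_mult using abs_moebius_le_1[of d] y by (intro mult_mono) auto
    also have "\<dots> \<le> 16 * sqrt y" using ln_mult_ln_le_sqrt[OF y] by simp
    finally show "\<bar>moebius d * ln (real N / real d) * (\<Sum>m=1..N div d. F (d * m))\<bar> \<le>
        16 * sqrt (real N / real d)"
      by (simp add: y_def M_def)
  qed
  also have "\<dots> = 16 * sqrt (real N) * (\<Sum>d=1..N. 1 / sqrt (real d))"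
    by (simp add: sum_distrib_left real_sqrt_divide)
  also have "\<dots> \<le> 16 * sqrt (real N) * (2 * sqrt (real N))"
    by (intro mult_left_mono sum_inverse_sqrt_le) auto
  finally have T': "\<bar>T\<bar> \<le> 32 * real N" by simp
  have g: "0 \<le> g" "g \<le> 1" using euler_mascheroni_0_1 by (simp_all add: g_def)
  have psi: "0 \<le> chebyshev_psi N" "chebyshev_psi N \<le> 4 * real N"
    by (simp_all add: chebyshev_psi_nonneg chebyshev_psi_le)
  have lnN: "0 \<le> ln (real N)" "ln (real N) \<le> real N"
    using assms ln_bound[of "real N"] by auto
  \<comment> \<open>Besides the 32 N for T, the errors are 8 N here, then 2 N and 4 N, whence
    46.\<close>
  have "0 \<le> (g + 1) * chebyshev_psi N" "(g + 1) * chebyshev_psi N \<le> 2 * (4 * real N)"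
    using g psi by (simp, intro mult_mono, auto)
  moreover have "0 \<le> (g + 1) * ln (real N)" "(g + 1) * ln (real N) \<le> 2 * real N"
    using g lnN by (auto intro!: mult_mono)
  moreover have "real N * (ln (real N) - 1) \<le> real N * L" "real N * L \<le> real N * (ln (real N) + 4)"
    using sum_mangoldt_over_id_ge[OF assms] sum_mangoldt_over_id_le[OF assms]
    by (intro mult_left_mono; simp add: L_def)+
  moreover have "F 1 * ln (real N) =
      chebyshev_psi N * ln (real N) - real N * ln (real N) + (g + 1) * ln (real N)"
    by (simp add: F_def algebra_simps)
  ultimately show ?thesis
    using T T' unfolding S_def[symmetric] by (simp add: abs_le_iff algebra_simps)
qed

text \<open>The difference of Selberg's formula at n and m, with the convolution term discarded
  because it increases with N; this one-sided use costs only the factor 2. The 142 is 46 * 3 from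
  the two error terms, as n \<le> 2 m, plus 4 from ln n - ln m.\<close>

lemma chebyshev_psi_short_interval_le:
  assumes "0 < m" "m \<le> n" "n \<le> 2 * m"
  shows "(chebyshev_psi n - chebyshev_psi m) * ln (real m) \<le>
    2 * real (n - m) * ln (real m) + 142 * real m"
proof -
  define A where "A N = chebyshev_psi N * ln (real N) +
    (\<Sum>i=1..N. mangoldt i * chebyshev_psi (N div i))" for N
  have n: "n > 0" using assms by simp
  have "(\<Sum>i=1..m. mangoldt i * chebyshev_psi (m div i)) \<le>
      (\<Sum>i=1..m. mangoldt i * chebyshev_psi (n div i))"
    using assms by (intro sum_mono mult_left_mono chebyshev_psi_mono div_le_mono mangoldt_nonneg)
  also have "\<dots> \<le> (\<Sum>i=1..n. mangoldt i * chebyshev_psi (n div i))"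
    using assms by (intro sum_mono2) (auto simp: mangoldt_nonneg chebyshev_psi_nonneg)
  finally have 1: "chebyshev_psi n * ln (real n) - chebyshev_psi m * ln (real m) \<le> A n - A m"
    by (simp add: A_def)
  have 2: "chebyshev_psi n * ln (real m) \<le> chebyshev_psi n * ln (real n)"
    using assms by (intro mult_left_mono chebyshev_psi_nonneg) auto
  have "A n - A m \<le> 2 * real n * ln (real n) - 2 * real m * ln (real m) + 46 * real n + 46 * real m"
    using selberg_formula[OF assms(1)] selberg_formula[OF n] by (simp add: A_def abs_le_iff)
  moreover have "ln (real n) - ln (real m) \<le> real (n - m) / real m"
  proof -
    have "ln (real n / real m) \<le> real n / real m - 1"
      using assms by (intro ln_le_minus_one) auto
    also have "\<dots> = real (n - m) / real m" using assms by (simp add: of_nat_diff field_simps)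
    finally show ?thesis using assms by (simp add: ln_div)
  qed
  then have "real n * (ln (real n) - ln (real m)) \<le> (2 * real m) * (real (n - m) / real m)"
    using assms by (intro mult_mono) auto
  then have "real n * (ln (real n) - ln (real m)) \<le> 2 * real (n - m)" using assms by simp
  moreover have "2 * real n * ln (real n) - 2 * real m * ln (real m) =
      2 * real (n - m) * ln (real m) + 2 * (real n * (ln (real n) - ln (real m)))"
    using assms by (simp add: of_nat_diff algebra_simps)
  moreover have "real n \<le> 2 * real m" "real (n - m) \<le> real m" using assms by linarith+
  ultimately show ?thesis using 1 2 by (simp add: algebra_simps)
qed

section \<open>Reciprocal sums of primes\<close>

definition recip_sum :: "nat set \<Rightarrow> real" where
  "recip_sum P = (\<Sum>p\<in>P. 1 / real p)"

lemma recip_sum_nonneg: "recip_sum P \<ge> 0"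
  by (simp add: recip_sum_def sum_nonneg)

lemma recip_sum_mono: "finite Q \<Longrightarrow> P \<subseteq> Q \<Longrightarrow> recip_sum P \<le> recip_sum Q"
  unfolding recip_sum_def by (intro sum_mono2) auto

lemma recip_sum_Un_le: "finite P \<Longrightarrow> finite Q \<Longrightarrow> recip_sum (P \<union> Q) \<le> recip_sum P + recip_sum Q"
  using recip_sum_nonneg[of "P \<inter> Q"] sum.union_inter[of P Q "\<lambda>p. 1 / real p"]
  by (simp add: recip_sum_def)

lemma recip_sum_Un_disjoint:
  "finite P \<Longrightarrow> finite Q \<Longrightarrow> P \<inter> Q = {} \<Longrightarrow> recip_sum (P \<union> Q) = recip_sum P + recip_sum Q"
  by (simp add: recip_sum_def sum.union_disjoint)

lemma recip_sum_UN_le: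
  assumes "finite T" "\<And>t. t \<in> T \<Longrightarrow> finite (Q t)"
  shows "recip_sum (\<Union>t\<in>T. Q t) \<le> (\<Sum>t\<in>T. recip_sum (Q t))"
  using assms
proof (induction T rule: finite_induct)
  case (insert t T)
  have "recip_sum (Q t \<union> (\<Union>s\<in>T. Q s)) \<le> recip_sum (Q t) + recip_sum (\<Union>s\<in>T. Q s)"
    using insert by (intro recip_sum_Un_le) auto
  with insert show ?case by fastforce
qed (simp add: recip_sum_def)

definition primes_log :: "real \<Rightarrow> real \<Rightarrow> nat set" where
  "primes_log u v = {p. prime p \<and> u < ln (real p) \<and> ln (real p) \<le> v}"

lemma finite_ln_le: "finite {p :: nat. prime p \<and> ln (real p) \<le> v}"
proof (rule finite_subset)
  show "{p :: nat. prime p \<and> ln (real p) \<le> v} \<subseteq> {..nat \<lfloor>exp v\<rfloor>}"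
  proof safe
    fix p :: nat assume p: "prime p" "ln (real p) \<le> v"
    then have "real p \<le> exp v" 
      by (metis exp_le_cancel_iff exp_ln of_nat_0_less_iff prime_gt_0_nat)
    then show "p \<le> nat \<lfloor>exp v\<rfloor>" by (simp add: le_nat_floor)
  qed
qed simp

lemma finite_primes_log: "finite (primes_log u v)"
  unfolding primes_log_def by (rule finite_subset[OF _ finite_ln_le[of v]]) auto

section \<open>Prime reciprocals on the logarithmic scale\<close>

lemma sum_powers_from_2_le:
  assumes "0 \<le> x" "x \<le> (1 / 2 :: real)"
  shows "(\<Sum>k=2..n. x ^ k) \<le> 2 * x\<^sup>2"
proof (cases "n = 0")
  case False
  then have "n > 0" by simp
  \<comment> \<open>The remainder 2 x^(n+1) of the geometric series is kept so that the induction
    closes.\<close>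
  then have "(\<Sum>k=2..n. x ^ k) + 2 * x ^ Suc n \<le> 2 * x\<^sup>2"
  proof (induction n rule: nat_induct_non_zero)
    case (Suc n)
    have "x ^ Suc n * (2 * x) \<le> x ^ Suc n * 1"
      using assms by (intro mult_left_mono) auto
    then show ?case using Suc by (simp add: algebra_simps)
  qed (simp add: power2_eq_square)
  moreover have "x ^ Suc n \<ge> 0" using assms by simp
  ultimately show ?thesis by linarith
qed simp

text \<open>Proper prime powers contribute O(1) to Mertens' sum, uniformly in n: the sum over k is
  at most 2/p^2, and ln p \<le> 2 sqrt p.\<close>

lemma sum_mangoldt_proper_powers_le:
  "(\<Sum>i | i \<in> {1..n} \<and> \<not> prime i. mangoldt i / real i) \<le> 4 * (\<Sum>p. real p powr (- (3 / 2)))"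
proof -
  define f where "f p = real p powr (- (3 / 2))" for p :: nat
  have summ: "summable f" unfolding f_def by (subst summable_real_powr_iff) simp
  have f: "f p \<ge> 0" for p by (simp add: f_def)
  define A where "A = {p. prime p \<and> p \<in> {1..n}}"
  have "(\<Sum>i | i \<in> {1..n} \<and> \<not> prime i. mangoldt i / real i) =
      (\<Sum>i | i \<in> {1..n} \<and> \<not> prime i \<and> primepow i. mangoldt i / real i)"
    by (intro sum.mono_neutral_right) (auto simp: mangoldt_def)
  also have "\<dots> \<le> (\<Sum>(p, k)\<in>A \<times> {2..n}. ln (real p) / real p ^ k)"
  proof (rule sum_le_included[where i = "\<lambda>(p, k). p ^ k"])
    show "\<forall>i\<in>{i \<in> {1..n}. \<not> prime i \<and> primepow i}. \<exists>y\<in>A \<times> {2..n}.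
      (case y of (p, k) \<Rightarrow> p ^ k) = i \<and>
      mangoldt i / real i \<le> (case y of (p, k) \<Rightarrow> ln (real p) / real p ^ k)"
    proof safe
      fix i assume i: "i \<in> {1..n}" "\<not> prime i" "primepow i"
      then obtain p k where pk: "prime p" "k > 0" "i = p ^ k" by (auto simp: primepow_def)
      have "k \<noteq> 1" using pk i by auto
      with pk have "k \<ge> 2" by linarith
      have "p \<le> p ^ k" using pk by (intro self_le_power) (auto simp: Suc_le_eq prime_gt_0_nat)
      moreover have "k < p ^ k" using pk prime_gt_1_nat by (intro power_gt_expt) auto
      ultimately have "(p, k) \<in> A \<times> {2..n}"
        using pk i \<open>k \<ge> 2\<close> prime_ge_1_nat by (auto simp: A_def)
      then show "\<exists>y\<in>A \<times> {2..n}. (case y of (p, k) \<Rightarrow> p ^ k) = i \<and>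
          mangoldt i / real i \<le> (case y of (p, k) \<Rightarrow> ln (real p) / real p ^ k)"
        using pk by (intro bexI[of _ "(p, k)"]) auto
    qed
  qed (auto simp: A_def)
  also have "\<dots> = (\<Sum>p\<in>A. ln (real p) * (\<Sum>k=2..n. (1 / real p) ^ k))"
    by (simp add: sum.cartesian_product[symmetric] sum_distrib_left power_divide)
  also have "\<dots> \<le> (\<Sum>p\<in>A. 4 * f p)"
  proof (intro sum_mono)
    fix p assume "p \<in> A"
    then have "p \<ge> 2" by (auto simp: A_def prime_ge_2_nat)
    then have p: "real p \<ge> 2" by simp
    have "ln (real p) = 2 * ln (sqrt (real p))" using p by (simp add: ln_sqrt)
    also have "ln (sqrt (real p)) \<le> sqrt (real p)" using p by (intro ln_bound) auto
    finally have "ln (real p) * (\<Sum>k=2..n. (1 / real p) ^ k) \<le> (2 * sqrt (real p)) * (2 * (1 / real p)\<^sup>2)"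
      using p by (intro mult_mono sum_powers_from_2_le sum_nonneg) (auto simp: field_simps)
    also have "\<dots> = 4 * (real p powr (1 / 2) * real p powr (-2))"
      using p by (simp add: powr_half_sqrt powr_minus powr_numeral power_divide inverse_eq_divide)
    also have "real p powr (1 / 2) * real p powr (-2) = f p"
      unfolding f_def by (subst powr_add[symmetric]) simp
    finally show "ln (real p) * (\<Sum>k=2..n. (1 / real p) ^ k) \<le> 4 * f p" .
  qed
  also have "\<dots> = 4 * sum f A" by (simp add: sum_distrib_left)
  also have "sum f A \<le> suminf f"
    using summ f by (intro sum_le_suminf) (auto simp: A_def)
  finally show ?thesis by (simp add: f_def[abs_def])
qed

lemma recip_sum_primes_log_ge:
  "\<exists>D\<ge>1. \<forall>u\<ge>0. recip_sum (primes_log u (u + D)) \<ge> 1 / (u + D)"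
proof -
  define K where "K = 4 * (\<Sum>p. real p powr (- (3 / 2)))"
  have "K \<ge> 0" using sum_mangoldt_proper_powers_le[of 0] by (simp add: K_def)
  \<comment> \<open>The Mertens bounds lose 1 and 4, rounding n loses 1 and the prime powers lose K;
    the remaining 1 is the mass guaranteed in every window of length D.\<close>
  define D where "D = K + 7"
  have "recip_sum (primes_log u (u + D)) \<ge> 1 / (u + D)" if u: "u \<ge> 0" for u
  proof -
    define m n where "m = nat \<lfloor>exp u\<rfloor>" and "n = nat \<lfloor>exp (u + D)\<rfloor>"
    have m: "m \<ge> 1" using u by (simp add: m_def le_nat_floor)
    have mn: "m \<le> n" using \<open>K \<ge> 0\<close> by (auto simp: m_def n_def D_def intro!: nat_mono floor_mono)
    have "real m \<le> exp u" by (simp add: m_def)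
    then have lnm: "ln (real m) \<le> u" using m by (subst exp_le_cancel_iff[symmetric]) simp
    have "exp (u + D - 1) \<le> exp (u + D) - 1"
    proof -
      have "exp (u + D) = exp (u + D - 1) * exp 1" by (simp flip: exp_add)
      moreover have "exp (u + D - 1) * 2 \<le> exp (u + D - 1) * exp 1"
        using exp_ge_add_one_self[of 1] by (intro mult_left_mono) auto
      moreover have "exp (u + D - 1) \<ge> 1" using u \<open>K \<ge> 0\<close> by (simp add: D_def)
      ultimately show ?thesis by linarith
    qed
    also have "\<dots> \<le> real n" unfolding n_def by linarith
    finally have lnn: "ln (real n) \<ge> u + D - 1" using m mn by (subst ln_ge_iff) auto
    have "ln (real n) - 1 \<le> (\<Sum>i=1..n. mangoldt i / real i)"
      using m mn by (intro sum_mangoldt_over_id_ge) auto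
    also have "\<dots> = (\<Sum>i=1..m. mangoldt i / real i) + (\<Sum>i=m+1..n. mangoldt i / real i)"
    proof -
      have "{1..n} = {1..m} \<union> {m+1..n}" using m mn by auto
      then show ?thesis by (simp add: sum.union_disjoint)
    qed
    also have "(\<Sum>i=1..m. mangoldt i / real i) \<le> ln (real m) + 4"
      using m by (intro sum_mangoldt_over_id_le) auto
    also have "(\<Sum>i=m+1..n. mangoldt i / real i) =
        (\<Sum>i | i \<in> {m+1..n} \<and> prime i. mangoldt i / real i) +
        (\<Sum>i | i \<in> {m+1..n} \<and> \<not> prime i. mangoldt i / real i)"
      by (subst sum.union_disjoint[symmetric]) (auto intro!: sum.cong)
    also have "(\<Sum>i | i \<in> {m+1..n} \<and> \<not> prime i. mangoldt i / real i) \<le>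
        (\<Sum>i | i \<in> {1..n} \<and> \<not> prime i. mangoldt i / real i)"
      by (intro sum_mono2) (auto simp: mangoldt_nonneg)
    also have "\<dots> \<le> K" unfolding K_def by (rule sum_mangoldt_proper_powers_le)
    finally have "1 \<le> (\<Sum>i | i \<in> {m+1..n} \<and> prime i. mangoldt i / real i)"
      using lnm lnn by (simp add: D_def)
    also have "\<dots> \<le> (\<Sum>i | i \<in> {m+1..n} \<and> prime i. (u + D) * (1 / real i))"
    proof (intro sum_mono)
      fix i assume "i \<in> {i \<in> {m+1..n}. prime i}"
      then have i: "prime i" "i \<le> n" "i > 0" by (auto simp: prime_gt_0_nat)
      then have "real i \<le> exp (u + D)" by (simp add: n_def le_nat_iff le_floor_iff)
      then have "ln (real i) \<le> u + D" using i by (subst exp_le_cancel_iff[symmetric]) simp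
      then have "ln (real i) / real i \<le> (u + D) / real i" by (intro divide_right_mono) auto
      then show "mangoldt i / real i \<le> (u + D) * (1 / real i)" using i by simp
    qed
    also have "\<dots> = (u + D) * recip_sum {i \<in> {m+1..n}. prime i}"
      unfolding recip_sum_def sum_distrib_left ..
    also have "\<dots> \<le> (u + D) * recip_sum (primes_log u (u + D))"
    proof (intro mult_left_mono recip_sum_mono finite_primes_log)
      show "{i \<in> {m+1..n}. prime i} \<subseteq> primes_log u (u + D)"
      proof safe
        fix i assume i: "i \<in> {m+1..n}" "prime i"
        then have i0: "i > 0" by auto
        have "real i \<le> exp (u + D)" using i by (simp add: n_def le_nat_iff le_floor_iff)
        then have "ln (real i) \<le> u + D" using i0 by (subst exp_le_cancel_iff[symmetric]) simp
        moreover have "exp u < real i" using i unfolding m_def by (auto simp: Suc_le_eq) linarith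
        then have "u < ln (real i)" using i0 by (subst exp_less_cancel_iff[symmetric]) simp
        ultimately show "i \<in> primes_log u (u + D)" using i by (simp add: primes_log_def)
      qed
    qed (use u \<open>K \<ge> 0\<close> in \<open>auto simp: D_def\<close>)
    finally show ?thesis using u \<open>K \<ge> 0\<close> by (simp add: D_def field_simps)
  qed
  then show ?thesis using \<open>K \<ge> 0\<close> by (intro exI[of _ D]) (auto simp: D_def)
qed

text \<open>With X = e^u, the interval from X to X e^\<eta> has length at most 3/2 \<eta> X, so the
  short-interval bound has main term 3 \<eta> X. The condition on u makes the error 142 X / ln m at
  most \<eta> X / 2 and the rounding negligible. Any other absolute constant in place of 5 would
  serve.\<close>

lemma recip_sum_primes_short_interval_le:
  assumes "0 < \<eta>" "\<eta> \<le> 1 / 2" "u \<ge> 1 + 300 / \<eta>"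
  shows "recip_sum {p. prime p \<and> u \<le> ln (real p) \<and> ln (real p) \<le> u + \<eta>} \<le> 5 * \<eta> / u"
proof -
  define S where "S = {p :: nat. prime p \<and> u \<le> ln (real p) \<and> ln (real p) \<le> u + \<eta>}"
  have "300 / \<eta> \<ge> 600" using assms by (simp add: field_simps)
  then have u: "u > 600" using assms by linarith
  define X where "X = exp u"
  have X: "X > u" using exp_ge_add_one_self[of u] unfolding X_def by linarith
  \<comment> \<open>m is the largest integer below X, so that a prime with ln p = u exactly is
    counted; the clusters considered later start at such a prime.\<close>
  define m n where "m = nat \<lceil>X\<rceil> - 1" and "n = nat \<lfloor>exp (u + \<eta>)\<rfloor>"
  have mX: "real m < X" "X \<le> real m + 1"
    using X u unfolding m_def by (simp_all add: of_nat_diff) linarith+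
  have m: "m > 0" using mX X u by auto
  have "exp \<eta> \<le> 1 + \<eta> + \<eta>\<^sup>2" using assms by (intro exp_bound) auto
  also have "\<eta>\<^sup>2 \<le> \<eta> * (1 / 2)" unfolding power2_eq_square using assms by (intro mult_left_mono) auto
  finally have e: "exp \<eta> \<le> 1 + 3 / 2 * \<eta>" by simp
  then have "X * exp \<eta> \<le> X * (1 + 3 / 2 * \<eta>)" using X u by (intro mult_left_mono) auto
  then have eX: "exp (u + \<eta>) \<le> X + 3 / 2 * \<eta> * X" by (simp add: exp_add X_def algebra_simps)
  have nX: "real n \<le> exp (u + \<eta>)" by (simp add: n_def)
  have "X \<le> exp (u + \<eta>)" using assms by (simp add: X_def)
  then have mn: "m \<le> n" unfolding n_def using mX by (simp add: le_nat_iff le_floor_iff)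
  have "\<eta> * X \<le> 1 / 2 * X" using assms X u by (intro mult_right_mono) auto
  then have "real n \<le> real (2 * m)" using nX eX mX X u by linarith
  then have n2m: "n \<le> 2 * m" by linarith
  have lnm: "ln (real m) \<ge> u - 1"
  proof -
    have "exp u = exp (u - 1) * exp 1" by (simp flip: exp_add)
    moreover have "exp (u - 1) * 2 \<le> exp (u - 1) * exp 1"
      using exp_ge_add_one_self[of 1] by (intro mult_left_mono) auto
    moreover have "exp (u - 1) \<ge> 1" using u by simp
    ultimately have "exp (u - 1) \<le> X - 1" unfolding X_def by linarith
    then show ?thesis using mX m by (subst ln_ge_iff) auto
  qed
  have finS: "finite S" unfolding S_def by (rule finite_subset[OF _ finite_ln_le[of "u + \<eta>"]]) auto
  have S: "S \<subseteq> {m+1..n}"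
  proof
    fix p assume "p \<in> S"
    then have p: "prime p" "u \<le> ln (real p)" "ln (real p) \<le> u + \<eta>" "p > 0"
      by (auto simp: S_def prime_gt_0_nat)
    then have "X \<le> real p" unfolding X_def using ln_ge_iff[of "real p" u] by simp
    then have "m < p" using mX by linarith
    moreover have "real p \<le> exp (u + \<eta>)"
      using p(3,4) by (metis exp_le_cancel_iff exp_ln of_nat_0_less_iff)
    then have "p \<le> n" by (simp add: n_def le_nat_iff le_floor_iff)
    ultimately show "p \<in> {m+1..n}" by simp
  qed
  have "u * X * recip_sum S = (\<Sum>p\<in>S. u * (X * (1 / real p)))"
    unfolding recip_sum_def sum_distrib_left by (simp add: mult.assoc)
  also have "\<dots> \<le> (\<Sum>p\<in>S. mangoldt p)"
  proof (intro sum_mono)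
    fix p assume "p \<in> S"
    then have p: "prime p" "u \<le> ln (real p)" "p > 0" by (auto simp: S_def prime_gt_0_nat)
    then have "X \<le> real p" unfolding X_def using ln_ge_iff[of "real p" u] by simp
    then have "u * (X * (1 / real p)) \<le> u * 1"
      using u p by (intro mult_left_mono) (auto simp: field_simps)
    then show "u * (X * (1 / real p)) \<le> mangoldt p" using p by simp
  qed
  also have "\<dots> \<le> (\<Sum>p=m+1..n. mangoldt p)"
    using S by (intro sum_mono2) (auto simp: mangoldt_nonneg)
  also have "\<dots> = chebyshev_psi n - chebyshev_psi m"
  proof -
    have "{1..n} = {1..m} \<union> {m+1..n}" using m mn by auto
    then show ?thesis by (simp add: chebyshev_psi_def sum.union_disjoint)
  qed
  also have "\<dots> \<le> 2 * real (n - m) + 142 * real m / ln (real m)"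
    using chebyshev_psi_short_interval_le[OF m mn n2m] lnm u by (simp add: field_simps)
  also have "142 * real m / ln (real m) \<le> 142 * X / (300 / \<eta>)"
    using mX lnm assms X u by (intro frac_le) auto
  also have "2 * real (n - m) \<le> 3 * \<eta> * X + 2"
    using nX eX mX mn by (simp add: of_nat_diff)
  also have "3 * \<eta> * X + 2 + 142 * X / (300 / \<eta>) \<le> 5 * \<eta> * X"
  proof -
    have "\<eta> * u \<ge> 300"
      using assms by (simp add: field_simps)
    moreover have "\<eta> * u \<le> \<eta> * X" using assms X by (intro mult_left_mono) auto
    ultimately have "\<eta> * X \<ge> 300" by linarith
    then show ?thesis by (simp add: field_simps)
  qed
  finally have "X * (u * recip_sum S) \<le> X * (5 * \<eta>)" by (simp add: mult_ac)
  then have "u * recip_sum S \<le> 5 * \<eta>" using X u by simp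
  then show ?thesis using u by (simp add: S_def field_simps)
qed

lemma primes_log_split:
  "u \<le> v \<Longrightarrow> v \<le> w \<Longrightarrow> primes_log u w = primes_log u v \<union> primes_log v w"
  "primes_log u v \<inter> primes_log v w = {}"
  by (auto simp: primes_log_def)

text \<open>Consecutive windows of length D: the one ending at D j weighs at least 1/(D j).\<close>

lemma recip_sum_primes_log_ge_harm:
  assumes D: "D \<ge> 1" "\<And>u. u \<ge> 0 \<Longrightarrow> recip_sum (primes_log u (u + D)) \<ge> 1 / (u + D)"
  assumes "I \<le> J"
  shows "recip_sum (primes_log (D * real I) (D * real J)) \<ge> (harm J - harm I) / D"
  using \<open>I \<le> J\<close>
proof (induction J rule: dec_induct)
  case (step J)
  have "(harm (Suc J) - harm I) / D = (harm J - harm I) / D + 1 / (D * real J + D)"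
  proof -
    have "D * real J + D = D * real (Suc J)" by (simp add: algebra_simps)
    then have "1 / (D * real J + D) = inverse (real (Suc J)) / D"
      by (simp add: divide_inverse)
    then show ?thesis by (simp add: harm_Suc add_divide_distrib diff_divide_distrib)
  qed
  also have "\<dots> \<le> recip_sum (primes_log (D * real I) (D * real J)) +
      recip_sum (primes_log (D * real J) (D * real (Suc J)))"
    using step D(2)[of "D * real J"] D(1) by (intro add_mono) (auto simp: algebra_simps)
  also have "\<dots> = recip_sum (primes_log (D * real I) (D * real (Suc J)))"
    using step D(1)
    by (subst primes_log_split(1)[of _ "D * real J" "D * real (Suc J)"])
       (auto simp: recip_sum_Un_disjoint finite_primes_log primes_log_split(2))
  finally show ?case .
qed (simp add: recip_sum_nonneg)

text \<open>In a block of length \<eta>2 all elements lie within \<eta>2 of the least one, so the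
  forbidden gap pushes them within \<eta>1 of it. The short-interval bound applied to this cluster
  gains the factor \<eta>1/\<eta>2 over the harmonic sum of the blocks.\<close>

lemma recip_sum_log_gap_free_le:
  assumes \<eta>: "0 < \<eta>1" "\<eta>1 < \<eta>2" "\<eta>1 \<le> 1 / 2"
  assumes gap: "\<And>p q. p \<in> R \<Longrightarrow> q \<in> R \<Longrightarrow> \<not> (\<eta>1 \<le> ln (real q) - ln (real p) \<and> ln (real q) - ln (real p) \<le> \<eta>2)"
  assumes I: "real I * \<eta>2 \<ge> 1 + 300 / \<eta>1" "I \<le> J"
  shows "recip_sum (R \<inter> primes_log (real I * \<eta>2) (real J * \<eta>2)) \<le> 5 * \<eta>1 / \<eta>2 * harm J"
proof -
  have block: "recip_sum (R \<inter> primes_log (real i * \<eta>2) (real (Suc i) * \<eta>2)) \<le> 5 * \<eta>1 / \<eta>2 * (1 / real i)"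
    if "i \<ge> I" for i
  proof (cases "R \<inter> primes_log (real i * \<eta>2) (real (Suc i) * \<eta>2) = {}")
    case True
    then show ?thesis using \<eta> by (simp add: recip_sum_def)
  next
    case False
    define B where "B = R \<inter> primes_log (real i * \<eta>2) (real (Suc i) * \<eta>2)"
    have finB: "finite B" by (simp add: B_def finite_primes_log)
    define p where "p = Min B"
    have p: "p \<in> B" unfolding p_def using finB False by (intro Min_in) (auto simp: B_def)
    have prime: "prime q" if "q \<in> B" for q using that by (auto simp: B_def primes_log_def)
    define u where "u = ln (real p)"
    have "real I * \<eta>2 \<le> real i * \<eta>2" using \<open>i \<ge> I\<close> \<eta> by (intro mult_right_mono) auto
    then have u: "u > real i * \<eta>2" "u \<ge> 1 + 300 / \<eta>1" "real i * \<eta>2 \<ge> 1 + 300 / \<eta>1"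
      using p I by (auto simp: u_def B_def primes_log_def)
    have i: "real i * \<eta>2 > 0" using u(3) \<eta> by (smt (verit) divide_pos_pos)
    have "B \<subseteq> {q. prime q \<and> u \<le> ln (real q) \<and> ln (real q) \<le> u + \<eta>1}"
    proof safe
      fix q assume q: "q \<in> B"
      then have "p \<le> q" using finB by (simp add: p_def)
      then show le: "u \<le> ln (real q)"
        using prime_gt_0_nat[OF prime[OF p]] by (simp add: u_def)
      have "ln (real q) - u \<le> \<eta>2"
        using q u(1) by (auto simp: B_def primes_log_def algebra_simps)
      then show "ln (real q) \<le> u + \<eta>1"
        using gap[of p q] p q by (auto simp: B_def u_def)
    qed (use prime in auto)
    then have "recip_sum B \<le> recip_sum {q. prime q \<and> u \<le> ln (real q) \<and> ln (real q) \<le> u + \<eta>1}"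
      by (intro recip_sum_mono finite_subset[OF _ finite_ln_le[of "u + \<eta>1"]]) auto
    also have "\<dots> \<le> 5 * \<eta>1 / u"
      using \<eta> u by (intro recip_sum_primes_short_interval_le) auto
    also have "\<dots> \<le> 5 * \<eta>1 / (real i * \<eta>2)"
      using \<eta> u i by (intro divide_left_mono) auto
    finally show ?thesis using \<eta> by (simp add: B_def field_simps)
  qed
  have "recip_sum (R \<inter> primes_log (real I * \<eta>2) (real J * \<eta>2)) \<le> 5 * \<eta>1 / \<eta>2 * (\<Sum>i=I..<J. 1 / real i)"
    using I(2)
  proof (induction J rule: dec_induct)
    case (step J)
    have "R \<inter> primes_log (real I * \<eta>2) (real (Suc J) * \<eta>2) =
        (R \<inter> primes_log (real I * \<eta>2) (real J * \<eta>2)) \<union> (R \<inter> primes_log (real J * \<eta>2) (real (Suc J) * \<eta>2))"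
      using step \<eta> by (subst primes_log_split(1)[of _ "real J * \<eta>2"]) auto
    then have "recip_sum (R \<inter> primes_log (real I * \<eta>2) (real (Suc J) * \<eta>2)) \<le>
        recip_sum (R \<inter> primes_log (real I * \<eta>2) (real J * \<eta>2)) +
        recip_sum (R \<inter> primes_log (real J * \<eta>2) (real (Suc J) * \<eta>2))"
      by (simp only:) (intro recip_sum_Un_le; simp add: finite_primes_log)
    also have "\<dots> \<le> 5 * \<eta>1 / \<eta>2 * (\<Sum>i=I..<J. 1 / real i) + 5 * \<eta>1 / \<eta>2 * (1 / real J)"
      using step block[of J] by (intro add_mono) auto
    finally show ?case using step by (simp add: algebra_simps)
  next
    case base
    have "primes_log (real I * \<eta>2) (real I * \<eta>2) = {}" by (auto simp: primes_log_def)
    then show ?case by (simp add: recip_sum_def)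
  qed
  moreover have "(\<Sum>i=I..<J. 1 / real i) \<le> (\<Sum>i=1..J. 1 / real i)"
  proof (intro sum_mono2)
    have "300 / \<eta>1 > 0" using \<eta> by simp
    then have "real I * \<eta>2 > 0" using I(1) by linarith
    then have "I > 0" using \<eta> by (auto simp: zero_less_mult_iff)
    then show "{I..<J} \<subseteq> {1..J}" by auto
  qed auto
  then have "5 * \<eta>1 / \<eta>2 * (\<Sum>i=I..<J. 1 / real i) \<le> 5 * \<eta>1 / \<eta>2 * harm J"
    using \<eta> by (intro mult_left_mono) (simp_all add: harm_def inverse_eq_divide)
  ultimately show ?thesis by linarith
qed

section \<open>Logarithmic gaps that persist after deleting few primes\<close>

definition robust_for :: "real \<Rightarrow> real \<Rightarrow> real \<Rightarrow> nat set \<Rightarrow> bool" where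
  "robust_for h \<delta> \<rho> P \<longleftrightarrow> (\<forall>Q\<subseteq>P. recip_sum Q \<le> \<rho> * recip_sum P \<longrightarrow>
    (\<exists>p\<in>P - Q. \<exists>q\<in>P - Q. \<bar>ln (real q) - ln (real p) - h\<bar> < \<delta>))"

text \<open>The exceptional sets of primes met later are small only in proportion to the reciprocal
  sum, and only when that sum is large; hence the deleted set Q in \<open>robust_for\<close> and the
  arbitrary W here, with \<rho> independent of W.\<close>

definition robust_log_gap :: "real \<Rightarrow> real \<Rightarrow> real \<Rightarrow> bool" where
  "robust_log_gap h \<delta> \<rho> \<longleftrightarrow>
    (\<forall>W. \<exists>P. finite P \<and> (\<forall>p\<in>P. prime p) \<and> recip_sum P \<ge> W \<and> robust_for h \<delta> \<rho> P)"

text \<open>Compactness: if every h in [\<eta>1, \<eta>2] failed, finitely many intervals around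
  failing h would cover it. Deleting the corresponding exceptional sets costs at most a quarter of
  the weight of P and leaves a set without logarithmic gaps in [\<eta>1, \<eta>2]; such a set weighs
  at most about half of what is guaranteed for P.\<close>

lemma exists_robust_log_gap:
  assumes "\<epsilon> > 0"
  shows "\<exists>h. 0 < h \<and> h < \<epsilon> \<and> (\<forall>\<delta>>0. \<exists>\<rho>>0. robust_log_gap h \<delta> \<rho>)"
proof (rule ccontr)
  assume contra: "\<not> ?thesis"
  obtain D where D: "D \<ge> 1" "\<And>u. u \<ge> 0 \<Longrightarrow> recip_sum (primes_log u (u + D)) \<ge> 1 / (u + D)"
    using recip_sum_primes_log_ge by blast
  obtain L :: nat where L: "D / min \<epsilon> (1 / 2) < real L" using reals_Archimedean2 by blast
  have "D / min \<epsilon> (1 / 2) > 0" using assms D by simp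
  then have L0: "real L > 0" using L by linarith
  \<comment> \<open>Exactly L blocks of length \<eta>2 fill a window of length D, so the lower and
    the upper estimate refer to the same range of primes.\<close>
  define \<eta>2 where "\<eta>2 = D / real L"
  \<comment> \<open>The factor 10 D turns the cluster bound 5 \<eta>1/\<eta>2 into 1/(2 D), half the
    density 1/D known from below.\<close>
  define \<eta>1 where "\<eta>1 = \<eta>2 / (10 * D)"
  have \<eta>2: "0 < \<eta>2" "\<eta>2 < \<epsilon>" "\<eta>2 < 1 / 2"
  proof -
    have m: "min \<epsilon> (1 / 2) > 0" using assms by simp
    then have "D < real L * min \<epsilon> (1 / 2)" using L by (simp add: field_simps)
    then have "\<eta>2 < min \<epsilon> (1 / 2)"
      unfolding \<eta>2_def using L0 by (subst pos_divide_less_eq) (simp_all add: mult.commute)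
    then show "\<eta>2 < \<epsilon>" "\<eta>2 < 1 / 2" by simp_all
    show "0 < \<eta>2" using D(1) L0 by (simp add: \<eta>2_def)
  qed
  have "\<eta>2 * 1 < \<eta>2 * (10 * D)" using \<eta>2 D by (intro mult_strict_left_mono) auto
  then have \<eta>1: "0 < \<eta>1" "\<eta>1 < \<eta>2" using \<eta>2 D by (auto simp: \<eta>1_def field_simps)
  have "\<forall>h\<in>{\<eta>1..\<eta>2}. \<exists>\<delta>>0. \<forall>\<rho>>0. \<not> robust_log_gap h \<delta> \<rho>"
    using contra \<eta>1 \<eta>2 by fastforce
  \<comment> \<open>\<delta> depends on h alone and defeats every \<rho>, so \<rho> may be fixed
    after the finite subcover.\<close>
  then obtain \<delta> where \<delta>: "\<And>h. h \<in> {\<eta>1..\<eta>2} \<Longrightarrow> \<delta> h > 0"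
      "\<And>h \<rho>. h \<in> {\<eta>1..\<eta>2} \<Longrightarrow> \<rho> > 0 \<Longrightarrow> \<not> robust_log_gap h (\<delta> h) \<rho>"
    by metis
  have "{\<eta>1..\<eta>2} \<subseteq> (\<Union>h\<in>{\<eta>1..\<eta>2}. ball h (\<delta> h))" using \<delta>(1) by fastforce
  then obtain T where T: "T \<subseteq> {\<eta>1..\<eta>2}" "finite T" "{\<eta>1..\<eta>2} \<subseteq> (\<Union>h\<in>T. ball h (\<delta> h))"
    using compactE_image[of "{\<eta>1..\<eta>2}" "{\<eta>1..\<eta>2}" "\<lambda>h. ball h (\<delta> h)"] by auto
  have "T \<noteq> {}" using T(3) \<eta>1 by auto
  then have cT: "real (card T) > 0" using T(2) by (simp add: card_gt_0_iff)
  define \<rho> where "\<rho> = 1 / (4 * real (card T))"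
  have \<rho>: "\<rho> > 0" using cT by (simp add: \<rho>_def)
  have "\<forall>h\<in>T. \<exists>W. \<forall>P. finite P \<and> (\<forall>p\<in>P. prime p) \<and> recip_sum P \<ge> W \<longrightarrow> \<not> robust_for h (\<delta> h) \<rho> P"
  proof
    fix h assume "h \<in> T"
    then have "\<not> robust_log_gap h (\<delta> h) \<rho>" using \<delta>(2) \<rho> T(1) by blast
    then show "\<exists>W. \<forall>P. finite P \<and> (\<forall>p\<in>P. prime p) \<and> recip_sum P \<ge> W \<longrightarrow> \<not> robust_for h (\<delta> h) \<rho> P"
      unfolding robust_log_gap_def by blast
  qed
  then obtain W where W: "\<forall>h\<in>T. \<forall>P. finite P \<and> (\<forall>p\<in>P. prime p) \<and> recip_sum P \<ge> W h \<longrightarrow>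
      \<not> robust_for h (\<delta> h) \<rho> P"
    using bchoice[of T "\<lambda>h W. \<forall>P. finite P \<and> (\<forall>p\<in>P. prime p) \<and> recip_sum P \<ge> W \<longrightarrow> \<not> robust_for h (\<delta> h) \<rho> P"]
    by blast
  define Wmax where "Wmax = Max (insert 1 (W ` T))"
  have Wmax: "Wmax \<ge> 1" "\<And>h. h \<in> T \<Longrightarrow> W h \<le> Wmax"
    using T(2) by (auto simp: Wmax_def)
  obtain I :: nat where I: "(1 + 300 / \<eta>1) / D < real I" using reals_Archimedean2 by blast
  then have I': "real (I * L) * \<eta>2 \<ge> 1 + 300 / \<eta>1"
    using D(1) L0 by (simp add: \<eta>2_def field_simps)
  have "filterlim (harm :: nat \<Rightarrow> real) at_top sequentially" by (rule harm_at_top)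
  \<comment> \<open>Room for the weight Wmax, and for 3/4 (harm J - harm I) to exceed (harm J + 2 +
    ln L)/2.\<close>
  then have "\<forall>\<^sub>F J in sequentially. harm J \<ge> harm I + D * Wmax + 3 * harm I + 2 * (2 + ln (real L)) + 1"
    by (simp only: filterlim_at_top)
  then have "\<forall>\<^sub>F J in sequentially. J \<ge> I + 1 \<and> harm J \<ge> harm I + D * Wmax + 3 * harm I + 2 * (2 + ln (real L)) + 1"
    using eventually_ge_at_top[of "I + 1"] by eventually_elim auto
  then obtain J where J: "J \<ge> I + 1" "harm J \<ge> harm I + D * Wmax + 3 * harm I + 2 * (2 + ln (real L)) + 1"
    by (auto simp: eventually_sequentially)
  define P where "P = primes_log (D * real I) (D * real J)"
  have P: "finite P" "\<And>p. p \<in> P \<Longrightarrow> prime p" by (auto simp: P_def finite_primes_log) (simp add: primes_log_def)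
  have lnL: "ln (real L) \<ge> 0" using L0 by simp
  have hI: "harm I \<ge> (0 :: real)" by (rule harm_nonneg)
  have WP: "recip_sum P \<ge> (harm J - harm I) / D"
    unfolding P_def using J by (intro recip_sum_primes_log_ge_harm D) auto
  have "Wmax \<le> (harm J - harm I) / D" using J hI lnL D(1) by (simp add: field_simps)
  then have WP': "recip_sum P \<ge> Wmax" using WP by linarith
  have "\<forall>h\<in>T. \<exists>Q. Q \<subseteq> P \<and> recip_sum Q \<le> \<rho> * recip_sum P \<and>
        (\<forall>p\<in>P - Q. \<forall>q\<in>P - Q. \<not> \<bar>ln (real q) - ln (real p) - h\<bar> < \<delta> h)"
  proof
    fix h assume h: "h \<in> T"
    then have "recip_sum P \<ge> W h" using WP' Wmax(2) by (meson order_trans)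
    then have "\<not> robust_for h (\<delta> h) \<rho> P" using W h P by blast
    then show "\<exists>Q. Q \<subseteq> P \<and> recip_sum Q \<le> \<rho> * recip_sum P \<and>
        (\<forall>p\<in>P - Q. \<forall>q\<in>P - Q. \<not> \<bar>ln (real q) - ln (real p) - h\<bar> < \<delta> h)"
      unfolding robust_for_def by blast
  qed
  from bchoice[OF this] obtain Q where Q': "\<forall>h\<in>T. Q h \<subseteq> P \<and> recip_sum (Q h) \<le> \<rho> * recip_sum P \<and>
        (\<forall>p\<in>P - Q h. \<forall>q\<in>P - Q h. \<not> \<bar>ln (real q) - ln (real p) - h\<bar> < \<delta> h)"
    by blast
  then have Q: "\<And>h. h \<in> T \<Longrightarrow> Q h \<subseteq> P" "\<And>h. h \<in> T \<Longrightarrow> recip_sum (Q h) \<le> \<rho> * recip_sum P"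
      "\<And>h p q. h \<in> T \<Longrightarrow> p \<in> P - Q h \<Longrightarrow> q \<in> P - Q h \<Longrightarrow> \<not> \<bar>ln (real q) - ln (real p) - h\<bar> < \<delta> h"
    by blast+
  define U where "U = (\<Union>h\<in>T. Q h)"
  have finQ: "finite (Q h)" if "h \<in> T" for h using Q(1)[OF that] P(1) finite_subset by blast
  have "recip_sum U \<le> (\<Sum>h\<in>T. recip_sum (Q h))"
    unfolding U_def using T finQ by (intro recip_sum_UN_le) auto
  also have "\<dots> \<le> (\<Sum>h\<in>T. \<rho> * recip_sum P)" by (intro sum_mono Q)
  also have "\<dots> = recip_sum P / 4" using cT by (simp add: \<rho>_def)
  finally have U: "recip_sum U \<le> recip_sum P / 4" .
  define R where "R = P - U"
  have "recip_sum P \<le> recip_sum (R \<union> U)"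
    using P(1) finQ T(2) by (intro recip_sum_mono) (auto simp: R_def U_def)
  also have "\<dots> \<le> recip_sum R + recip_sum U"
    using P(1) finQ T(2) by (intro recip_sum_Un_le) (auto simp: R_def U_def)
  finally have R: "recip_sum R \<ge> 3 / 4 * recip_sum P" using U by linarith
  have "\<not> (\<eta>1 \<le> ln (real q) - ln (real p) \<and> ln (real q) - ln (real p) \<le> \<eta>2)"
    if pq: "p \<in> R" "q \<in> R" for p q
  proof
    assume "\<eta>1 \<le> ln (real q) - ln (real p) \<and> ln (real q) - ln (real p) \<le> \<eta>2"
    then have "ln (real q) - ln (real p) \<in> {\<eta>1..\<eta>2}" by simp
    then have "ln (real q) - ln (real p) \<in> (\<Union>h\<in>T. ball h (\<delta> h))" using T(3) by blast
    then obtain h where h: "h \<in> T" "\<bar>ln (real q) - ln (real p) - h\<bar> < \<delta> h"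
      by (auto simp: dist_real_def abs_minus_commute)
    moreover have "p \<in> P - Q h" "q \<in> P - Q h" using pq h by (auto simp: R_def U_def)
    ultimately show False using Q(3) by blast
  qed
  then have "recip_sum (R \<inter> primes_log (real (I * L) * \<eta>2) (real (J * L) * \<eta>2)) \<le> 5 * \<eta>1 / \<eta>2 * harm (J * L)"
    using \<eta>1 \<eta>2 I' J by (intro recip_sum_log_gap_free_le) auto
  moreover have "R \<inter> primes_log (real (I * L) * \<eta>2) (real (J * L) * \<eta>2) = R"
  proof -
    have "real (K * L) * \<eta>2 = D * real K" for K using L0 by (simp add: \<eta>2_def)
    then show ?thesis by (simp only:) (auto simp: R_def P_def)
  qed
  moreover have "5 * \<eta>1 / \<eta>2 = 1 / (2 * D)" using \<eta>2 by (simp add: \<eta>1_def)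
  ultimately have "recip_sum R \<le> harm (J * L) / (2 * D)" by simp
  \<comment> \<open>Cutting each window into L blocks adds only ln L + 2, independently of
    J.\<close>
  moreover have "harm (J * L) \<le> harm J + 2 + ln (real L)"
  proof -
    have JL: "J * L > 0" "J > 0" "L > 0" using J L0 by auto
    have "harm (J * L) \<le> ln (real (J * L)) + 1 + 1 / real (J * L)"
      using harm_minus_ln_bounds(2)[OF JL(1)] euler_mascheroni_0_1 by simp
    also have "1 / real (J * L) \<le> 1" using JL(1) by (simp del: of_nat_mult)
    also have "ln (real (J * L)) = ln (real J) + ln (real L)" using JL by (simp add: ln_mult)
    also have "ln (real J) \<le> harm J"
      using harm_minus_ln_bounds(1)[OF JL(2)] euler_mascheroni_0_1 by simp
    finally show ?thesis by simp
  qed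
  then have "harm (J * L) / (2 * D) \<le> (harm J + 2 + ln (real L)) / (2 * D)"
    using D(1) by (intro divide_right_mono) auto
  ultimately have "3 / 4 * ((harm J - harm I) / D) \<le> (harm J + 2 + ln (real L)) / (2 * D)"
    using R WP by linarith
  then have "(3 / 4 * (harm J - harm I)) / D \<le> ((harm J + 2 + ln (real L)) / 2) / D" by simp
  then have "3 / 4 * (harm J - harm I) \<le> (harm J + 2 + ln (real L)) / 2"
    using D(1) by (subst (asm) divide_le_cancel) auto
  then have "harm J \<le> 3 * harm I + 2 * (2 + ln (real L))" by (simp add: field_simps)
  moreover have "D * Wmax \<ge> 0" using D(1) Wmax(1) by simp
  ultimately show False using J(2) hI by linarith
qed

section \<open>Families averaging over primes\<close>

text \<open>The error in \<open>prime_average\<close> is the standard deviation from Turan-Kubilius.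
  Relative to the total weight it is B / sqrt (recip_sum P), negligible for sets of large reciprocal
  sum. This is the only relation between different levels.\<close>

locale prime_averaging_family =
  fixes H :: "nat \<Rightarrow> real \<Rightarrow> complex" and B :: real
  assumes norm_le: "norm (H k v) \<le> B"
    and lipschitz: "norm (H k v - H k w) \<le> 2 * B * \<bar>v - w\<bar>"
    and prime_average: "finite P \<Longrightarrow> (\<And>p. p \<in> P \<Longrightarrow> prime p) \<Longrightarrow>
      norm (of_real (recip_sum P) * H k v - (\<Sum>p\<in>P. of_real (1 / real p) * H (Suc k) (v + ln (real p))))
        \<le> B * sqrt (recip_sum P)"
begin

lemma B_nonneg: "B \<ge> 0"
  using norm_le[of 0 0] norm_ge_zero order_trans by blast

section \<open>Increments and extremal chains\<close>

definition increment :: "real \<Rightarrow> nat \<Rightarrow> real \<Rightarrow> complex" where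
  "increment h k v = H k (v + h) - H k v"

lemma norm_increment_le: "norm (increment h k v) \<le> 2 * B"
  unfolding increment_def using norm_triangle_ineq4[of "H k (v + h)" "H k v"] norm_le[of k "v + h"] norm_le[of k v]
  by linarith

lemma increment_lipschitz: "norm (increment h k v - increment h k w) \<le> 4 * B * \<bar>v - w\<bar>"
proof -
  have "increment h k v - increment h k w = (H k (v + h) - H k (w + h)) - (H k v - H k w)"
    by (simp add: increment_def)
  then have "norm (increment h k v - increment h k w) \<le> norm (H k (v + h) - H k (w + h)) + norm (H k v - H k w)"
    using norm_triangle_ineq4 by metis
  also have "\<dots> \<le> 2 * B * \<bar>v - w\<bar> + 2 * B * \<bar>v - w\<bar>"
    using lipschitz[of k "v + h" "w + h"] lipschitz[of k v w] by simp
  finally show ?thesis by simp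
qed

lemma increment_prime_average:
  assumes "finite P" "\<And>p. p \<in> P \<Longrightarrow> prime p"
  shows "norm (of_real (recip_sum P) * increment h k v -
    (\<Sum>p\<in>P. of_real (1 / real p) * increment h (Suc k) (v + ln (real p)))) \<le> 2 * B * sqrt (recip_sum P)"
proof -
  have "of_real (recip_sum P) * increment h k v -
      (\<Sum>p\<in>P. of_real (1 / real p) * increment h (Suc k) (v + ln (real p))) =
    (of_real (recip_sum P) * H k (v + h) - (\<Sum>p\<in>P. of_real (1 / real p) * H (Suc k) (v + h + ln (real p)))) -
    (of_real (recip_sum P) * H k v - (\<Sum>p\<in>P. of_real (1 / real p) * H (Suc k) (v + ln (real p))))"
    by (simp add: increment_def right_diff_distrib sum_subtractf add_ac)
  also have "norm \<dots> \<le> B * sqrt (recip_sum P) + B * sqrt (recip_sum P)"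
    by (intro order_trans[OF norm_triangle_ineq4] add_mono prime_average assms)
  finally show ?thesis by simp
qed

text \<open>Markov's inequality with weights 1/p for the deficit M - Re (...), which is nonnegative
  since M bounds all increments; its weighted mean is at most M \<tau>0 up to the averaging
  error.\<close>

lemma recip_sum_bad_primes_le:
  assumes P: "finite P" "\<And>p. p \<in> P \<Longrightarrow> prime p"
    and M: "\<And>k v. norm (increment h k v) \<le> M" "M > 0"
    and \<omega>: "norm \<omega> = 1" and \<tau>: "\<tau> > 0"
    and v: "Re (\<omega> * increment h k v) \<ge> M * (1 - \<tau>0)"
  shows "M * \<tau> * recip_sum {p \<in> P. Re (\<omega> * increment h (Suc k) (v + ln (real p))) < M * (1 - \<tau>)} \<le>
    M * \<tau>0 * recip_sum P + 2 * B * sqrt (recip_sum P)"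
proof -
  define W where "W = recip_sum P"
  define e where "e p = Re (\<omega> * increment h (Suc k) (v + ln (real p)))" for p :: nat
  define Q where "Q = {p \<in> P. e p < M * (1 - \<tau>)}"
  have e: "e p \<le> M" for p
    using complex_Re_le_cmod[of "\<omega> * increment h (Suc k) (v + ln (real p))"] \<omega> M(1)[of "Suc k" "v + ln (real p)"]
    unfolding e_def norm_mult by simp
  have "M * \<tau> * recip_sum Q = (\<Sum>p\<in>Q. 1 / real p * (M * \<tau>))"
    unfolding recip_sum_def by (simp add: sum_distrib_left)
  also have "\<dots> \<le> (\<Sum>p\<in>Q. 1 / real p * (M - e p))"
    by (intro sum_mono mult_left_mono) (auto simp: Q_def algebra_simps)
  also have "\<dots> \<le> (\<Sum>p\<in>P. 1 / real p * (M - e p))"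
    using P e by (intro sum_mono2 mult_nonneg_nonneg) (auto simp: Q_def)
  also have "\<dots> = M * W - (\<Sum>p\<in>P. 1 / real p * e p)"
    by (simp add: W_def recip_sum_def sum_subtractf right_diff_distrib sum_distrib_left)
  finally have 1: "M * \<tau> * recip_sum Q \<le> M * W - (\<Sum>p\<in>P. 1 / real p * e p)" .
  have 2: "(\<Sum>p\<in>P. 1 / real p * e p) = W * Re (\<omega> * increment h k v) -
      Re (\<omega> * (of_real W * increment h k v - (\<Sum>p\<in>P. of_real (1 / real p) * increment h (Suc k) (v + ln (real p)))))"
  proof -
    have *: "e p / real p = Re (\<omega> * (of_real (1 / real p) * increment h (Suc k) (v + ln (real p))))" for p
      unfolding e_def by (simp add: mult.left_commute[of \<omega>] del: of_real_divide)
    show ?thesis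
      by (simp add: right_diff_distrib sum_distrib_left mult.left_commute[of \<omega>] * del: of_real_divide)
  qed
  have 3: "Re (\<omega> * (of_real W * increment h k v -
      (\<Sum>p\<in>P. of_real (1 / real p) * increment h (Suc k) (v + ln (real p))))) \<le> 2 * B * sqrt W"
    using increment_prime_average[OF P, of h k v] \<omega>
    by (intro order_trans[OF complex_Re_le_cmod]) (simp add: norm_mult W_def)
  have 4: "W * Re (\<omega> * increment h k v) \<ge> W * (M * (1 - \<tau>0))"
    using v by (intro mult_left_mono) (auto simp: W_def recip_sum_nonneg)
  have "M * W - W * (M * (1 - \<tau>0)) = M * \<tau>0 * W" by (simp add: algebra_simps)
  then have "M * \<tau> * recip_sum Q \<le> M * \<tau>0 * W + 2 * B * sqrt W"
    using 1 2 3 4 by linarith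
  then show ?thesis by (simp add: Q_def e_def W_def)
qed

text \<open>An almost extremal increment forces almost extremal increments, one level up, along most
  primes. A pair of primes with logarithmic gap close to \<open>h\<close> therefore prolongs a chain of almost
  extremal increments at spacing \<open>h\<close> by one step.\<close>

lemma extremal_chain:
  assumes h: "\<And>\<delta>. \<delta> > 0 \<Longrightarrow> \<exists>\<rho>>0. robust_log_gap h \<delta> \<rho>"
    and M: "\<And>k v. norm (increment h k v) \<le> M" "M > 0"
      "\<And>\<epsilon>. \<epsilon> > 0 \<Longrightarrow> \<exists>k v. norm (increment h k v) > M - \<epsilon>"
    and "\<tau> > 0"
  shows "\<exists>k v \<omega>. norm \<omega> = 1 \<and> (\<forall>j\<le>J. Re (\<omega> * increment h k (v + real j * h)) \<ge> M * (1 - \<tau>))"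
  using \<open>\<tau> > 0\<close>
proof (induction J arbitrary: \<tau>)
  case 0
  \<comment> \<open>The cap 1/2 keeps the increment away from 0, so that it can be rotated onto the
    positive real axis.\<close>
  define \<epsilon> where "\<epsilon> = M * min \<tau> (1 / 2)"
  have \<epsilon>: "\<epsilon> > 0" "\<epsilon> \<le> M * \<tau>" "\<epsilon> \<le> M / 2"
    using 0 M(2) by (auto simp: \<epsilon>_def min_def)
  obtain k v where kv: "norm (increment h k v) > M - \<epsilon>" using M(3)[OF \<epsilon>(1)] by blast
  define z where "z = increment h k v"
  have z: "norm z > M - \<epsilon>" "z \<noteq> 0" using kv \<epsilon> M(2) by (auto simp: z_def)
  have "norm (cnj (sgn z)) = 1" using z by (simp add: norm_sgn)
  moreover have "cnj (sgn z) * z = of_real (norm z)"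
  proof -
    have "cnj (sgn z) * z = (z * cnj z) / of_real (norm z)"
      by (simp add: sgn_div_norm scaleR_conv_of_real divide_inverse mult_ac)
    also have "\<dots> = of_real (norm z)"
      using z unfolding complex_norm_square[symmetric] by (simp add: power2_eq_square)
    finally show ?thesis .
  qed
  then have "Re (cnj (sgn z) * increment h k (v + real 0 * h)) \<ge> M * (1 - \<tau>)"
    using z \<epsilon> by (simp add: z_def algebra_simps)
  ultimately show ?case by blast
next
  case (Suc J)
  note \<tau> = Suc.prems
  \<comment> \<open>By the Lipschitz bound a displacement by \<delta> costs at most M \<tau> / 2,
    half of the allowed loss.\<close>
  define \<delta> where "\<delta> = M * \<tau> / (8 * B + 8)"
  have \<delta>: "\<delta> > 0" using M(2) \<tau> B_nonneg by (simp add: \<delta>_def)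
  have \<delta>': "4 * B * \<delta> \<le> M * (\<tau> / 2)"
  proof -
    have "B / (8 * B + 8) \<le> 1 / 8" using B_nonneg by (simp add: field_simps)
    then have "4 * (M * \<tau>) * (B / (8 * B + 8)) \<le> 4 * (M * \<tau>) * (1 / 8)"
      using M(2) \<tau> by (intro mult_left_mono) auto
    then show ?thesis by (simp add: \<delta>_def mult_ac)
  qed
  obtain \<rho> where \<rho>: "\<rho> > 0" "robust_log_gap h \<delta> \<rho>" using h[OF \<delta>] by blast
  \<comment> \<open>With this \<tau>0, and X below keeping the averaging error within M \<tau>0 W,
    the bad primes for each of the J + 1 points weigh at most \<rho>/(J + 1) of P, hence at most
    \<rho> of P altogether.\<close>
  define \<tau>0 where "\<tau>0 = \<rho> * \<tau> / (4 * real (Suc J))"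
  have "\<tau>0 > 0" using \<rho> \<tau> by (simp add: \<tau>0_def)
  from Suc.IH[OF this] obtain k v \<omega> where \<omega>: "norm \<omega> = 1"
    and v: "\<And>j. j \<le> J \<Longrightarrow> Re (\<omega> * increment h k (v + real j * h)) \<ge> M * (1 - \<tau>0)"
    by blast
  define X where "X = 8 * B * real (Suc J) / (M * \<tau> * \<rho>)"
  obtain P where P: "finite P" "\<And>p. p \<in> P \<Longrightarrow> prime p" "recip_sum P \<ge> X\<^sup>2"
    and robust: "robust_for h \<delta> \<rho> P"
    using \<rho>(2)[unfolded robust_log_gap_def, THEN spec, of "X\<^sup>2"] by blast
  define W where "W = recip_sum P"
  have W: "W \<ge> 0" by (simp add: W_def recip_sum_nonneg)
  have X: "X \<le> sqrt W" using P(3) real_le_rsqrt by (simp add: W_def)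
  define Q where "Q j = {p \<in> P. Re (\<omega> * increment h (Suc k) (v + real j * h + ln (real p))) < M * (1 - \<tau> / 2)}" for j
  have Q: "recip_sum (Q j) \<le> \<rho> / real (Suc J) * W" if "j \<le> J" for j
  proof -
    have "M * (\<tau> / 2) * recip_sum (Q j) \<le> M * \<tau>0 * W + 2 * B * sqrt W"
      unfolding Q_def W_def using P M(1,2) \<omega> \<tau> v[OF that] by (intro recip_sum_bad_primes_le) auto
    also have "2 * B * sqrt W \<le> M * \<tau>0 * W"
    proof -
      have "2 * B = M * \<tau>0 * X" using M(2) \<tau> \<rho> by (simp add: X_def \<tau>0_def del: of_nat_Suc)
      then have "2 * B * sqrt W = M * \<tau>0 * X * sqrt W" by simp
      also have "\<dots> \<le> M * \<tau>0 * sqrt W * sqrt W"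
        using X M(2) \<open>\<tau>0 > 0\<close> W by (intro mult_right_mono mult_left_mono) auto
      finally show ?thesis using W by (simp add: mult.assoc)
    qed
    finally have "M * \<tau> * recip_sum (Q j) \<le> M * \<tau> * (\<rho> / real (Suc J) * W)"
      by (simp add: \<tau>0_def mult_ac del: of_nat_Suc)
    then show ?thesis using mult_pos_pos[OF M(2) \<tau>] by (simp only: mult_le_cancel_left_pos)
  qed
  define U where "U = (\<Union>j\<in>{..J}. Q j)"
  have "recip_sum U \<le> (\<Sum>j\<in>{..J}. recip_sum (Q j))"
    unfolding U_def using P(1) by (intro recip_sum_UN_le) (auto simp: Q_def)
  also have "\<dots> \<le> (\<Sum>j\<in>{..J}. \<rho> / real (Suc J) * W)" using Q by (intro sum_mono) auto
  also have "\<dots> = \<rho> * W" by (simp del: of_nat_Suc)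
  finally have "recip_sum U \<le> \<rho> * recip_sum P" by (simp add: W_def)
  moreover have "U \<subseteq> P" by (auto simp: U_def Q_def)
  ultimately obtain p q where pq: "p \<in> P - U" "q \<in> P - U" "\<bar>ln (real q) - ln (real p) - h\<bar> < \<delta>"
    using robust unfolding robust_for_def by blast
  have good: "Re (\<omega> * increment h (Suc k) (v + real j * h + ln (real r))) \<ge> M * (1 - \<tau> / 2)"
    if "j \<le> J" "r \<in> P - U" for j r
    using that by (auto simp: U_def Q_def not_less)
  have "M * (1 - \<tau> / 2) \<ge> M * (1 - \<tau>)" using M(2) \<tau> by (intro mult_left_mono) auto
  have "Re (\<omega> * increment h (Suc k) (v + ln (real p) + real j * h)) \<ge> M * (1 - \<tau>)" if "j \<le> Suc J" for j
  proof (cases "j \<le> J")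
    case True
    have "v + ln (real p) + real j * h = v + real j * h + ln (real p)" by simp
    then show ?thesis
      using good[OF True pq(1)] \<open>M * (1 - \<tau> / 2) \<ge> M * (1 - \<tau>)\<close> by (metis order_trans)
  next
    case False
    \<comment> \<open>The first J + 1 points come from p, the new endpoint from q: the good point v
      + J h + ln q differs from v + ln p + (J + 1) h by less than \<delta>.\<close>
    then have j: "j = Suc J" using that by simp
    define a b where "a = increment h (Suc k) (v + real J * h + ln (real q))"
      and "b = increment h (Suc k) (v + ln (real p) + real j * h)"
    have "norm (a - b) \<le> 4 * B * \<bar>(v + real J * h + ln (real q)) - (v + ln (real p) + real j * h)\<bar>"
      unfolding a_def b_def by (rule increment_lipschitz)
    also have "(v + real J * h + ln (real q)) - (v + ln (real p) + real j * h) = ln (real q) - ln (real p) - h"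
      by (simp add: j algebra_simps)
    also have "4 * B * \<bar>ln (real q) - ln (real p) - h\<bar> \<le> 4 * B * \<delta>"
      using pq(3) B_nonneg by (intro mult_left_mono) auto
    finally have "norm (a - b) \<le> M * (\<tau> / 2)" using \<delta>' by linarith
    then have "Re (\<omega> * (a - b)) \<le> M * (\<tau> / 2)"
      using complex_Re_le_cmod[of "\<omega> * (a - b)"] \<omega> by (simp add: norm_mult)
    moreover have "Re (\<omega> * a) \<ge> M * (1 - \<tau> / 2)" unfolding a_def using good[of J q] pq(2) by simp
    ultimately show ?thesis unfolding b_def[symmetric] by (simp add: right_diff_distrib algebra_simps)
  qed
  then show ?case using \<omega> by blast
qed

lemma increment_eq_0:
  assumes h: "\<And>\<delta>. \<delta> > 0 \<Longrightarrow> \<exists>\<rho>>0. robust_log_gap h \<delta> \<rho>"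
  shows "increment h k v = 0"
proof (rule ccontr)
  assume nz: "increment h k v \<noteq> 0"
  \<comment> \<open>The supremum is over all levels, because each extension of a chain raises the
    level by one.\<close>
  define A where "A = range (\<lambda>(k, v). norm (increment h k v))"
  define M where "M = Sup A"
  have bdd: "bdd_above A" using norm_increment_le by (auto simp: A_def intro!: bdd_aboveI[of _ "2 * B"])
  have M1: "norm (increment h k v) \<le> M" for k v
    unfolding M_def by (rule cSup_upper[OF _ bdd]) (force simp: A_def)
  have M2: "M > 0" using M1[of k v] nz by (metis less_le_trans zero_less_norm_iff)
  have M3: "\<exists>k v. norm (increment h k v) > M - \<epsilon>" if "\<epsilon> > 0" for \<epsilon>
  proof -
    have "\<exists>x\<in>A. M - \<epsilon> < x"
      using that less_cSup_iff[OF _ bdd, of "M - \<epsilon>"] by (auto simp: M_def A_def)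
    then show ?thesis by (auto simp: A_def)
  qed
  \<comment> \<open>J increments of real part at least M/2 telescope to more than 2 B.\<close>
  obtain J :: nat where J: "4 * B / M < real J" using reals_Archimedean2 by blast
  obtain k' v' \<omega> where \<omega>: "norm \<omega> = 1"
    and e: "\<And>j. j \<le> J \<Longrightarrow> Re (\<omega> * increment h k' (v' + real j * h)) \<ge> M * (1 - 1 / 2)"
    using extremal_chain[OF h M1 M2 M3, of "1 / 2" J] by auto
  have "real J * (M / 2) = (\<Sum>j<J. M * (1 - 1 / 2))" by simp
  also have "\<dots> \<le> (\<Sum>j<J. Re (\<omega> * increment h k' (v' + real j * h)))"
    by (intro sum_mono e) auto
  also have "\<dots> = (\<Sum>j<J. Re (\<omega> * H k' (v' + real (Suc j) * h)) - Re (\<omega> * H k' (v' + real j * h)))"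
    by (intro sum.cong) (auto simp: increment_def right_diff_distrib algebra_simps)
  also have "\<dots> = Re (\<omega> * H k' (v' + real J * h)) - Re (\<omega> * H k' (v' + real 0 * h))"
    by (rule sum_lessThan_telescope)
  also have "\<dots> = Re (\<omega> * (H k' (v' + real J * h) - H k' v'))" by (simp add: right_diff_distrib)
  also have "\<dots> \<le> norm (H k' (v' + real J * h) - H k' v')"
    using complex_Re_le_cmod[of "\<omega> * (H k' (v' + real J * h) - H k' v')"] \<omega> by (simp add: norm_mult)
  also have "\<dots> \<le> 2 * B"
    using norm_triangle_ineq4[of "H k' (v' + real J * h)" "H k' v'"] norm_le[of k' "v' + real J * h"] norm_le[of k' v']
    by linarith
  finally show False using J M2 by (simp add: field_simps)
qed

text \<open>Arbitrarily small periods bring v to within one period of w; the Lipschitz bound,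
  uniform in the period, covers the rest.\<close>

lemma translation_invariant: "H k v = H k w"
proof -
  have *: "H k v = H k w" if "v \<le> w" for v w
  proof -
    have "norm (H k v - H k w) \<le> 0 + \<epsilon>" if \<epsilon>: "\<epsilon> > 0" for \<epsilon>
    proof -
      define \<eta> where "\<eta> = \<epsilon> / (2 * B + 1)"
      have \<eta>: "\<eta> > 0" "2 * B * \<eta> \<le> \<epsilon>"
        using \<epsilon> B_nonneg by (auto simp: \<eta>_def field_simps)
      obtain h where h: "0 < h" "h < \<eta>" "\<forall>\<delta>>0. \<exists>\<rho>>0. robust_log_gap h \<delta> \<rho>"
        using exists_robust_log_gap[OF \<eta>(1)] by blast
      have per: "H k (v + real n * h) = H k v" for n
      proof (induction n)
        case (Suc n)
        have "increment h k (v + real n * h) = 0" using h(3) by (intro increment_eq_0) auto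
        then show ?case using Suc by (simp add: increment_def algebra_simps)
      qed simp
      define n where "n = nat \<lfloor>(w - v) / h\<rfloor>"
      have "(w - v) / h \<ge> 0" using h(1) \<open>v \<le> w\<close> by simp
      then have "real n \<le> (w - v) / h" "(w - v) / h \<le> real n + 1"
        unfolding n_def by linarith+
      then have "\<bar>v + real n * h - w\<bar> \<le> h" using h(1) by (simp add: field_simps abs_le_iff)
      then have "2 * B * \<bar>v + real n * h - w\<bar> \<le> 2 * B * \<eta>"
        using h B_nonneg by (intro mult_left_mono) auto
      then show ?thesis using lipschitz[of k "v + real n * h" w] \<eta>(2) per[of n] by simp
    qed
    then have "norm (H k v - H k w) \<le> 0" by (rule field_le_epsilon)
    then show ?thesis by simp
  qed
  show ?thesis using *[of v w] *[of w v] linear[of v w] by metis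
qed

text \<open>Since level k + 1 is constant, \<open>prime_average\<close> reads W d \<le> B sqrt W,
  with d the distance of the two levels; \<open>robust_log_gap\<close> supplies sets of primes with
  W as large as desired.\<close>

lemma level_independent: "H (Suc k) v = H k v"
proof (rule ccontr)
  assume "H (Suc k) v \<noteq> H k v"
  then have d: "norm (H k v - H (Suc k) v) > 0" by simp
  define d where "d = norm (H k v - H (Suc k) v)"
  obtain h \<rho> where rob: "robust_log_gap h 1 \<rho>"
    using exists_robust_log_gap[of 1] by (meson zero_less_one)
  obtain P where P: "finite P" "\<And>p. p \<in> P \<Longrightarrow> prime p" "recip_sum P \<ge> ((B + 1) / d)\<^sup>2"
    using rob[unfolded robust_log_gap_def, THEN spec, of "((B + 1) / d)\<^sup>2"] by blast
  define W where "W = recip_sum P"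
  have pos: "(B + 1) / d > 0" using d B_nonneg by (simp add: d_def)
  then have W: "sqrt W \<ge> (B + 1) / d" using P(3) real_le_rsqrt by (simp add: W_def)
  then have W0: "sqrt W > 0" using pos by linarith
  have "(\<Sum>p\<in>P. of_real (1 / real p) * H (Suc k) (v + ln (real p))) = of_real W * H (Suc k) v"
  proof -
    have "H (Suc k) (v + ln (real p)) = H (Suc k) v" for p :: nat by (rule translation_invariant)
    then show ?thesis by (simp add: W_def recip_sum_def sum_distrib_right)
  qed
  then have "norm (of_real W * (H k v - H (Suc k) v)) \<le> B * sqrt W"
    using prime_average[OF P(1,2), of k v] by (simp add: W_def right_diff_distrib)
  moreover have "norm (of_real W * (H k v - H (Suc k) v)) = sqrt W * (sqrt W * d)"
    using W0 by (simp add: norm_mult d_def flip: mult.assoc)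
  ultimately have "sqrt W * (sqrt W * d) \<le> sqrt W * B" by (simp add: mult.commute)
  then have "sqrt W * d \<le> B" using W0 by (simp only: mult_le_cancel_left_pos)
  moreover have "sqrt W * d \<ge> B + 1" using W d by (simp add: d_def field_simps)
  ultimately show False by simp
qed

end

section \<open>The Turan--Kubilius inequality\<close>

lemma sum_multiples:
  fixes f :: "nat \<Rightarrow> 'a :: comm_monoid_add"
  assumes "d > 0"
  shows "(\<Sum>n | n \<in> {1..m} \<and> d dvd n. f n) = (\<Sum>j=1..m div d. f (d * j))"
proof (rule sum.reindex_bij_witness[of _ "\<lambda>j. d * j" "\<lambda>n. n div d"])
  fix n assume "n \<in> {n. n \<in> {1..m} \<and> d dvd n}"
  then obtain k where "n = d * k" "n \<le> m" "n \<ge> 1" by auto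
  then show "n div d \<in> {1..m div d}"
    using assms by (auto simp: less_eq_div_iff_mult_less_eq mult.commute Suc_le_eq intro!: Nat.gr0I)
next
  fix j assume "j \<in> {1..m div d}"
  then show "d * j \<in> {n. n \<in> {1..m} \<and> d dvd n}"
    using assms by (auto simp: less_eq_div_iff_mult_less_eq mult.commute Suc_le_eq)
qed (use assms in auto)

lemma card_multiples:
  assumes "d > 0"
  shows "card {n \<in> {1..m}. d dvd n} = m div d"
  using sum_multiples[OF assms, of "\<lambda>_. 1 :: nat" m] by simp

definition prime_divisor_count :: "nat set \<Rightarrow> nat \<Rightarrow> real" where
  "prime_divisor_count P n = (\<Sum>p\<in>P. of_bool (p dvd n))"

text \<open>After expanding the square, an upper bound for the second moment and a lower bound for
  the first suffice. Coprimality gives at most m/(p q) for p \<noteq> q, the diagonal contributes m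
  W, and rounding in the first moment is the source of the term with \<open>card P\<close>.\<close>

lemma turan_kubilius:
  assumes P: "finite P" "\<And>p. p \<in> P \<Longrightarrow> prime p"
  shows "(\<Sum>n=1..m. (prime_divisor_count P n - recip_sum P)\<^sup>2) \<le>
    real m * recip_sum P + 2 * recip_sum P * real (card P)"
proof -
  define W where "W = recip_sum P"
  have W: "W \<ge> 0" by (simp add: W_def recip_sum_nonneg)
  have count: "(\<Sum>n=1..m. of_bool (d dvd n)) = real (m div d)" if "d > 0" for d
  proof -
    have "(\<Sum>n=1..m. of_bool (d dvd n) :: real) = (\<Sum>n | n \<in> {1..m} \<and> d dvd n. 1)"
      by (intro sum.mono_neutral_cong_right) auto
    then show ?thesis using card_multiples[OF that, of m] by simp
  qed
  have pos: "p > 0" if "p \<in> P" for p using P(2)[OF that] prime_gt_0_nat by blast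
  have "(\<Sum>n=1..m. prime_divisor_count P n) = (\<Sum>p\<in>P. \<Sum>n=1..m. of_bool (p dvd n))"
    unfolding prime_divisor_count_def by (rule sum.swap)
  also have "\<dots> = (\<Sum>p\<in>P. real (m div p))" using pos by (intro sum.cong count) auto
  also have "\<dots> \<ge> (\<Sum>p\<in>P. real m * (1 / real p) - 1)"
  proof (intro sum_mono)
    fix p show "real m * (1 / real p) - 1 \<le> real (m div p)"
      using real_of_int_div3[of "int m" "int p"] zdiv_int[of m p] by simp
  qed
  finally have 1: "(\<Sum>n=1..m. prime_divisor_count P n) \<ge> real m * W - real (card P)"
    by (simp add: sum_subtractf W_def recip_sum_def sum_distrib_left)
  have "(\<Sum>n=1..m. (prime_divisor_count P n)\<^sup>2) =
      (\<Sum>n=1..m. \<Sum>p\<in>P. \<Sum>q\<in>P. of_bool (p dvd n) * of_bool (q dvd n))"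
    by (simp add: prime_divisor_count_def power2_eq_square sum_product)
  also have "\<dots> = (\<Sum>p\<in>P. \<Sum>n=1..m. \<Sum>q\<in>P. of_bool (p dvd n) * of_bool (q dvd n))"
    by (rule sum.swap)
  also have "\<dots> = (\<Sum>p\<in>P. \<Sum>q\<in>P. \<Sum>n=1..m. of_bool (p dvd n) * of_bool (q dvd n))"
    by (intro sum.cong refl sum.swap)
  also have "\<dots> \<le> (\<Sum>p\<in>P. \<Sum>q\<in>P. real m * (1 / real p) * (1 / real q) + (if p = q then real m * (1 / real p) else 0))"
  proof (intro sum_mono)
    fix p q assume pq: "p \<in> P" "q \<in> P"
    show "(\<Sum>n=1..m. of_bool (p dvd n) * of_bool (q dvd n)) \<le>
        real m * (1 / real p) * (1 / real q) + (if p = q then real m * (1 / real p) else 0)"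
    proof (cases "p = q")
      case True
      have "(\<Sum>n=1..m. of_bool (p dvd n) * of_bool (q dvd n)) = (\<Sum>n=1..m. of_bool (p dvd n) :: real)"
        using True by (intro sum.cong) auto
      also have "\<dots> = real (m div p)" using pos pq by (intro count) auto
      also have "\<dots> \<le> real m / real p" by (rule of_nat_div_le_of_nat)
      finally show ?thesis unfolding if_P[OF True] by (rule order_trans) simp
    next
      case False
      have "coprime p q" using False P(2) pq primes_coprime by blast
      then have "p dvd n \<and> q dvd n \<longleftrightarrow> p * q dvd n" for n
        by (meson divides_mult dvd_mult_left dvd_mult_right)
      then have "(\<Sum>n=1..m. of_bool (p dvd n) * of_bool (q dvd n)) = (\<Sum>n=1..m. of_bool (p * q dvd n) :: real)"
        by (intro sum.cong) (auto simp flip: of_bool_conj)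
      also have "\<dots> = real (m div (p * q))" using pos pq by (intro count) auto
      also have "\<dots> \<le> real m / real (p * q)" by (rule of_nat_div_le_of_nat)
      finally show ?thesis unfolding if_not_P[OF False] by (rule order_trans) simp
    qed
  qed
  also have "\<dots> = real m * W * W + real m * W"
  proof -
    have "(\<Sum>q\<in>P. if p = q then real m * (1 / real p) else 0) = real m * (1 / real p)" if "p \<in> P" for p
      using that P(1) by simp
    then have "(\<Sum>p\<in>P. \<Sum>q\<in>P. if p = q then real m * (1 / real p) else 0) = real m * W"
      by (simp add: W_def recip_sum_def sum_distrib_left)
    moreover have "(\<Sum>p\<in>P. \<Sum>q\<in>P. real m * (1 / real p) * (1 / real q)) = real m * W * W"
    proof -
      have "real m * W * W = real m * (\<Sum>p\<in>P. \<Sum>q\<in>P. (1 / real p) * (1 / real q))"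
        unfolding W_def recip_sum_def mult.assoc sum_product ..
      then show ?thesis by (simp only: sum_distrib_left mult.assoc)
    qed
    ultimately show ?thesis by (simp only: sum.distrib)
  qed
  finally have 2: "(\<Sum>n=1..m. (prime_divisor_count P n)\<^sup>2) \<le> real m * W * W + real m * W" .
  have "(\<Sum>n=1..m. (prime_divisor_count P n - W)\<^sup>2) =
      (\<Sum>n=1..m. (prime_divisor_count P n)\<^sup>2) - 2 * W * (\<Sum>n=1..m. prime_divisor_count P n) + real m * W * W"
  proof -
    have "(prime_divisor_count P n - W)\<^sup>2 = (prime_divisor_count P n)\<^sup>2 - 2 * W * prime_divisor_count P n + W * W" for n
      by (simp add: power2_eq_square algebra_simps)
    then show ?thesis by (simp add: sum.distrib sum_subtractf sum_distrib_left)
  qed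
  also have "\<dots> \<le> (real m * W * W + real m * W) - 2 * W * (real m * W - real (card P)) + real m * W * W"
    using 1 2 W by (intro add_mono diff_mono mult_left_mono) auto
  finally show ?thesis by (simp add: W_def algebra_simps)
qed

text \<open>Cauchy-Schwarz on the variance bound: in a sum weighted by f, the count of prime
  divisors may be replaced by its mean \<open>recip_sum P\<close>.\<close>

lemma norm_sum_prime_divisor_count_le:
  fixes f :: "nat \<Rightarrow> complex"
  assumes P: "finite P" "\<And>p. p \<in> P \<Longrightarrow> prime p" and f: "\<And>n. n \<ge> 1 \<Longrightarrow> norm (f n) \<le> B" and B: "B \<ge> 0"
  shows "norm (\<Sum>n=1..m. f n * of_real (recip_sum P - prime_divisor_count P n)) \<le>
    B * sqrt (real m * (real m * recip_sum P + 2 * recip_sum P * real (card P)))"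
proof -
  define e where "e n = \<bar>prime_divisor_count P n - recip_sum P\<bar>" for n
  have "norm (\<Sum>n=1..m. f n * of_real (recip_sum P - prime_divisor_count P n)) \<le> (\<Sum>n=1..m. B * e n)"
    using f by (intro sum_norm_le) (auto simp: norm_mult e_def abs_minus_commute simp del: of_real_diff intro!: mult_right_mono)
  also have "\<dots> = B * (\<Sum>n=1..m. 1 * e n)" by (simp add: sum_distrib_left)
  also have "(\<Sum>n=1..m. 1 * e n) \<le> sqrt (real m * (real m * recip_sum P + 2 * recip_sum P * real (card P)))"
  proof (rule real_le_rsqrt)
    have "(\<Sum>n=1..m. 1 * e n)\<^sup>2 \<le> (\<Sum>n=1..m. 1\<^sup>2) * (\<Sum>n=1..m. (e n)\<^sup>2)"
      by (rule Cauchy_Schwarz_ineq_sum)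
    also have "\<dots> = real m * (\<Sum>n=1..m. (prime_divisor_count P n - recip_sum P)\<^sup>2)"
      by (simp add: e_def)
    also have "\<dots> \<le> real m * (real m * recip_sum P + 2 * recip_sum P * real (card P))"
      using turan_kubilius[OF P] by (intro mult_left_mono) auto
    finally show "(\<Sum>n=1..m. 1 * e n)\<^sup>2 \<le> real m * (real m * recip_sum P + 2 * recip_sum P * real (card P))" .
  qed
  finally show ?thesis using B by (simp add: mult_left_mono)
qed

text \<open>Chebyshev's inequality: such n deviate from the mean by the full
  \<open>recip_sum P\<close>.\<close>

lemma card_coprime_to_primes_le:
  assumes P: "finite P" "\<And>p. p \<in> P \<Longrightarrow> prime p" and W: "recip_sum P > 0"
  shows "real (card {n \<in> {1..m}. \<forall>p\<in>P. \<not> p dvd n}) \<le> (real m + 2 * real (card P)) / recip_sum P"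
proof -
  define A where "A = {n \<in> {1..m}. \<forall>p\<in>P. \<not> p dvd n}"
  have "real (card A) * (recip_sum P)\<^sup>2 = (\<Sum>n\<in>A. (prime_divisor_count P n - recip_sum P)\<^sup>2)"
    by (simp add: A_def prime_divisor_count_def)
  also have "\<dots> \<le> (\<Sum>n=1..m. (prime_divisor_count P n - recip_sum P)\<^sup>2)"
    by (intro sum_mono2) (auto simp: A_def)
  also have "\<dots> \<le> (real m + 2 * real (card P)) * recip_sum P"
    using turan_kubilius[OF P] by (simp add: algebra_simps)
  finally have "recip_sum P * (real (card A) * recip_sum P) \<le> recip_sum P * (real m + 2 * real (card P))"
    by (simp add: power2_eq_square mult_ac)
  then have "real (card A) * recip_sum P \<le> real m + 2 * real (card P)"
    using W by (simp only: mult_le_cancel_left_pos)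
  then show ?thesis using W by (simp add: A_def pos_le_divide_eq)
qed

section \<open>Passing to the limit\<close>

locale shift_compatible =
  fixes f :: "nat \<Rightarrow> nat \<Rightarrow> nat \<Rightarrow> complex" and B :: real
  assumes norm_f_le: "n \<ge> 1 \<Longrightarrow> norm (f N k n) \<le> B"
    and shift: "prime p \<Longrightarrow> c > 0 \<Longrightarrow>
      (\<lambda>N. (\<Sum>j=1..nat \<lfloor>real N * c\<rfloor> div p. norm (f N k (p * j) - f N (Suc k) j)) / real N) \<longlonglongrightarrow> 0"
begin

lemma B_nonneg: "B \<ge> 0"
  using norm_f_le[of 1 0 0] norm_ge_zero order_trans by blast

definition mean :: "nat \<Rightarrow> nat \<Rightarrow> real \<Rightarrow> complex" where
  "mean N k v = of_real (exp v / real N) * (\<Sum>n=1..nat \<lfloor>real N * exp (- v)\<rfloor>. f N k n)"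

lemma norm_sum_f_le:
  assumes "finite A" "\<And>n. n \<in> A \<Longrightarrow> n \<ge> 1"
  shows "norm (\<Sum>n\<in>A. f N k n) \<le> real (card A) * B"
proof -
  have "norm (\<Sum>n\<in>A. f N k n) \<le> (\<Sum>n\<in>A. B)"
    using assms(2) norm_f_le by (intro sum_norm_le) auto
  then show ?thesis by simp
qed

lemma norm_mean_le: "norm (mean N k v) \<le> B"
proof (cases "N = 0")
  case True
  then show ?thesis using B_nonneg by (simp add: mean_def)
next
  case False
  have "norm (mean N k v) \<le> exp v / real N * (real (nat \<lfloor>real N * exp (- v)\<rfloor>) * B)"
    unfolding mean_def norm_mult norm_of_real using norm_sum_f_le[of "{1..nat \<lfloor>real N * exp (- v)\<rfloor>}" N k]
    by (intro mult_mono) auto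
  also have "\<dots> \<le> exp v / real N * ((real N * exp (- v)) * B)"
    using B_nonneg by (intro mult_left_mono mult_right_mono) auto
  also have "\<dots> = B" using False by (simp add: exp_minus field_simps)
  finally show ?thesis .
qed

text \<open>Shortening the range and changing the normalisation each cost B (1 - y/x), and 1 - e^(v
  - w) \<le> w - v; the term with 1/N is rounding.\<close>

lemma mean_lipschitz:
  assumes "v \<le> w" "N > 0"
  shows "norm (mean N k v - mean N k w) \<le> 2 * B * \<bar>v - w\<bar> + B * exp v / real N"
proof -
  define x y where "x = real N * exp (- v)" and "y = real N * exp (- w)"
  have xy: "0 < y" "y \<le> x" using assms by (auto simp: x_def y_def)
  define m n where "m = nat \<lfloor>x\<rfloor>" and "n = nat \<lfloor>y\<rfloor>"
  have nm: "n \<le> m" using xy by (auto simp: m_def n_def intro!: nat_mono floor_mono)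
  have mn: "real m \<le> x" "real n \<le> y" "y \<le> real n + 1"
    using xy by (simp_all add: m_def n_def)
  have ev: "exp v / real N = 1 / x" "exp w / real N = 1 / y"
    using assms by (simp_all add: x_def y_def exp_minus field_simps)
  have "{1..m} = {1..n} \<union> {n+1..m}" using nm by auto
  then have "(\<Sum>i=1..m. f N k i) = (\<Sum>i=1..n. f N k i) + (\<Sum>i=n+1..m. f N k i)"
    by (simp add: sum.union_disjoint)
  then have "mean N k v - mean N k w =
      of_real (1 / x) * (\<Sum>i=n+1..m. f N k i) - of_real (1 / y - 1 / x) * (\<Sum>i=1..n. f N k i)"
    unfolding mean_def ev x_def[symmetric] y_def[symmetric] m_def[symmetric] n_def[symmetric]
    by (simp add: algebra_simps)
  also have "norm \<dots> \<le> 1 / x * (real (m - n) * B) + (1 / y - 1 / x) * (real n * B)"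
  proof (intro order_trans[OF norm_triangle_ineq4] add_mono)
    show "norm (of_real (1 / x) * (\<Sum>i=n+1..m. f N k i)) \<le> 1 / x * (real (m - n) * B)"
      unfolding norm_mult norm_of_real using norm_sum_f_le[of "{n+1..m}" N k] xy by (intro mult_mono) auto
    have "1 / y - 1 / x \<ge> 0" using xy by (simp add: field_simps)
    then show "norm (of_real (1 / y - 1 / x) * (\<Sum>i=1..n. f N k i)) \<le> (1 / y - 1 / x) * (real n * B)"
      unfolding norm_mult norm_of_real using norm_sum_f_le[of "{1..n}" N k] by (intro mult_mono) (auto simp del: of_real_diff)
  qed
  also have "\<dots> \<le> 1 / x * ((x - y + 1) * B) + (1 / y - 1 / x) * (y * B)"
    using mn xy nm B_nonneg
    by (intro add_mono mult_left_mono mult_right_mono) (auto simp: of_nat_diff field_simps)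
  also have "\<dots> = 2 * B * (1 - y / x) + B / x" using xy by (simp add: field_simps)
  finally have "norm (mean N k v - mean N k w) \<le> 2 * B * (1 - y / x) + B / x" .
  moreover have "y / x = exp (v - w)"
    using assms by (simp add: x_def y_def exp_minus exp_diff field_simps)
  then have "1 - y / x \<le> \<bar>v - w\<bar>" using exp_ge_add_one_self[of "v - w"] by linarith
  then have "2 * B * (1 - y / x) \<le> 2 * B * \<bar>v - w\<bar>" using B_nonneg by (intro mult_left_mono) auto
  moreover have "B / x = B * exp v / real N" by (simp add: x_def exp_minus field_simps)
  ultimately show ?thesis by linarith
qed

text \<open>Both errors come from the sum of f over pairs (p, j) with p j \<le> N e^(-v). Grouping
  by n = p j gives f weighted by \<open>prime_divisor_count\<close>, which Turan-Kubilius replaces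
  by its mean; the second error trades level k at p j for level k + 1 at j.\<close>

lemma mean_prime_average:
  assumes P: "finite P" "\<And>p. p \<in> P \<Longrightarrow> prime p" and N: "N > 0"
  shows "norm (of_real (recip_sum P) * mean N k v -
      (\<Sum>p\<in>P. of_real (1 / real p) * mean N (Suc k) (v + ln (real p)))) \<le>
    B * sqrt (recip_sum P + 2 * recip_sum P * real (card P) * exp v / real N) +
    exp v * (\<Sum>p\<in>P. (\<Sum>j=1..nat \<lfloor>real N * exp (- v)\<rfloor> div p. norm (f N k (p * j) - f N (Suc k) j)) / real N)"
proof -
  define W where "W = recip_sum P"
  define m where "m = nat \<lfloor>real N * exp (- v)\<rfloor>"
  define c where "c = exp v / real N"
  have c: "c > 0" using N by (simp add: c_def)
  have cm: "c * real m \<le> 1"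
  proof -
    have "c * real m \<le> c * (real N * exp (- v))" using c by (intro mult_left_mono) (auto simp: m_def)
    then show ?thesis using N by (simp add: c_def exp_minus field_simps)
  qed
  have W: "W \<ge> 0" by (simp add: W_def recip_sum_nonneg)
  have pos: "p > 0" if "p \<in> P" for p using P(2)[OF that] prime_gt_0_nat by blast
  \<comment> \<open>Nested floors agree, so the mean at v + ln p runs over exactly j \<le> m div p,
    and the factors 1/p and p cancel.\<close>
  have mean_p: "of_real (1 / real p) * mean N (Suc k) (v + ln (real p)) =
      of_real c * (\<Sum>j=1..m div p. f N (Suc k) j)" if "p \<in> P" for p
  proof -
    have "real N * exp (- (v + ln (real p))) = real N * exp (- v) / real_of_int (int p)"
      using pos[OF that] by (simp add: exp_diff)
    then have "\<lfloor>real N * exp (- (v + ln (real p)))\<rfloor> = \<lfloor>real N * exp (- v)\<rfloor> div int p"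
      by (simp only: floor_divide_real_eq_div)
    then have "nat \<lfloor>real N * exp (- (v + ln (real p)))\<rfloor> = m div p"
      by (simp add: m_def nat_div_distrib)
    moreover have "1 / real p * (exp (v + ln (real p)) / real N) = c"
      using pos[OF that] by (simp add: c_def exp_add)
    ultimately show ?thesis
      unfolding mean_def by (metis mult.assoc of_real_mult)
  qed
  have "(\<Sum>n=1..m. f N k n * of_real (prime_divisor_count P n)) =
      (\<Sum>n=1..m. \<Sum>p\<in>P. of_bool (p dvd n) * f N k n)"
    by (auto simp: prime_divisor_count_def sum_distrib_left of_bool_def intro!: sum.cong)
  also have "\<dots> = (\<Sum>p\<in>P. \<Sum>n=1..m. of_bool (p dvd n) * f N k n)" by (rule sum.swap)
  also have "\<dots> = (\<Sum>p\<in>P. \<Sum>j=1..m div p. f N k (p * j))"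
  proof (rule sum.cong[OF refl])
    fix p assume "p \<in> P"
    have "(\<Sum>n=1..m. of_bool (p dvd n) * f N k n) = (\<Sum>n | n \<in> {1..m} \<and> p dvd n. f N k n)"
      by (intro sum.mono_neutral_cong_right) auto
    then show "(\<Sum>n=1..m. of_bool (p dvd n) * f N k n) = (\<Sum>j=1..m div p. f N k (p * j))"
      using sum_multiples[OF pos[OF \<open>p \<in> P\<close>]] by simp
  qed
  finally have count: "(\<Sum>n=1..m. f N k n * of_real (prime_divisor_count P n)) =
      (\<Sum>p\<in>P. \<Sum>j=1..m div p. f N k (p * j))" .
  have "of_real W * mean N k v - (\<Sum>p\<in>P. of_real (1 / real p) * mean N (Suc k) (v + ln (real p))) =
      of_real c * (of_real W * (\<Sum>n=1..m. f N k n) - (\<Sum>p\<in>P. \<Sum>j=1..m div p. f N (Suc k) j))"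
    using mean_p by (simp add: mean_def c_def m_def algebra_simps sum_distrib_left)
  also have "of_real W * (\<Sum>n=1..m. f N k n) - (\<Sum>p\<in>P. \<Sum>j=1..m div p. f N (Suc k) j) =
      (\<Sum>n=1..m. f N k n * of_real (W - prime_divisor_count P n)) +
      (\<Sum>p\<in>P. \<Sum>j=1..m div p. f N k (p * j) - f N (Suc k) j)"
    using count by (simp add: sum_subtractf right_diff_distrib sum_distrib_left mult.commute)
  finally have eq: "of_real W * mean N k v -
      (\<Sum>p\<in>P. of_real (1 / real p) * mean N (Suc k) (v + ln (real p))) =
    of_real c * ((\<Sum>n=1..m. f N k n * of_real (W - prime_divisor_count P n)) +
      (\<Sum>p\<in>P. \<Sum>j=1..m div p. f N k (p * j) - f N (Suc k) j))" .
  have "norm (of_real W * mean N k v -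
      (\<Sum>p\<in>P. of_real (1 / real p) * mean N (Suc k) (v + ln (real p)))) \<le> c * (B * sqrt (real m * (real m * W + 2 * W * real (card P))) +
      (\<Sum>p\<in>P. \<Sum>j=1..m div p. norm (f N k (p * j) - f N (Suc k) j)))"
    unfolding eq norm_mult norm_of_real
  proof (rule mult_mono)
    show "\<bar>c\<bar> \<le> c" "0 \<le> c" using c by simp_all
    show "norm ((\<Sum>n=1..m. f N k n * of_real (W - prime_divisor_count P n)) +
        (\<Sum>p\<in>P. \<Sum>j=1..m div p. f N k (p * j) - f N (Suc k) j)) \<le>
      B * sqrt (real m * (real m * W + 2 * W * real (card P))) +
        (\<Sum>p\<in>P. \<Sum>j=1..m div p. norm (f N k (p * j) - f N (Suc k) j))"
    proof (intro order_trans[OF norm_triangle_ineq] add_mono)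
      show "norm (\<Sum>n=1..m. f N k n * of_real (W - prime_divisor_count P n)) \<le>
          B * sqrt (real m * (real m * W + 2 * W * real (card P)))"
        unfolding W_def by (intro norm_sum_prime_divisor_count_le P norm_f_le B_nonneg)
      show "norm (\<Sum>p\<in>P. \<Sum>j=1..m div p. f N k (p * j) - f N (Suc k) j) \<le>
          (\<Sum>p\<in>P. \<Sum>j=1..m div p. norm (f N k (p * j) - f N (Suc k) j))"
        by (intro sum_norm_le norm_sum)
    qed
  qed (rule norm_ge_zero)
  also have "\<dots> = B * (c * sqrt (real m * (real m * W + 2 * W * real (card P)))) +
      c * (\<Sum>p\<in>P. \<Sum>j=1..m div p. norm (f N k (p * j) - f N (Suc k) j))"
    by (simp only: distrib_left mult.left_commute[of c B])
  finally have main: "norm (of_real W * mean N k v -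
      (\<Sum>p\<in>P. of_real (1 / real p) * mean N (Suc k) (v + ln (real p)))) \<le>
    B * (c * sqrt (real m * (real m * W + 2 * W * real (card P)))) +
      c * (\<Sum>p\<in>P. \<Sum>j=1..m div p. norm (f N k (p * j) - f N (Suc k) j))" .
  have "c * sqrt (real m * (real m * W + 2 * W * real (card P))) =
      sqrt ((c * real m) * ((c * real m) * W + 2 * W * real (card P) * c))"
  proof -
    have *: "c * sqrt Z = sqrt (c\<^sup>2 * Z)" for Z using c by (simp add: real_sqrt_mult)
    show ?thesis
      unfolding * by (rule arg_cong[where f = sqrt]) (simp add: algebra_simps power2_eq_square)
  qed
  also have "\<dots> \<le> sqrt (1 * (1 * W + 2 * W * real (card P) * c))"
    using cm c W by (intro real_sqrt_le_mono mult_mono add_mono) auto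
  finally have "B * (c * sqrt (real m * (real m * W + 2 * W * real (card P)))) \<le>
      B * sqrt (W + 2 * W * real (card P) * exp v / real N)"
    using B_nonneg by (intro mult_left_mono) (simp_all add: c_def)
  moreover have "c * (\<Sum>p\<in>P. \<Sum>j=1..m div p. norm (f N k (p * j) - f N (Suc k) j)) =
      exp v * (\<Sum>p\<in>P. (\<Sum>j=1..m div p. norm (f N k (p * j) - f N (Suc k) j)) / real N)"
    by (simp add: c_def sum_divide_distrib[symmetric])
  ultimately show ?thesis using main unfolding W_def m_def by linarith
qed

text \<open>Tychonoff's theorem for the functions sending (k, v) to \<open>mean N k v\<close>. The
  index set is uncountable, so compactness is used through a cluster point and a filter converging
  to it instead of a subsequence.\<close>

lemma exists_limit_filter:
  assumes "F \<noteq> bot"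
  shows "\<exists>G H. G \<noteq> bot \<and> G \<le> F \<and> (\<forall>k v. ((\<lambda>N. mean N k v) \<longlongrightarrow> H k v) G)"
proof -
  define K :: "(nat \<times> real \<Rightarrow> complex) set" where "K = PiE UNIV (\<lambda>_. cball 0 B)"
  define h where "h N = (\<lambda>(k, v). mean N k v)" for N
  have "compactin (product_topology (\<lambda>_. euclidean) UNIV) K"
    unfolding K_def compactin_PiE by simp
  then have "compact K" by (simp add: euclidean_product_topology)
  moreover have "filtermap h F \<noteq> bot" using assms by (simp add: filtermap_bot_iff)
  moreover have "eventually (\<lambda>x. x \<in> K) (filtermap h F)"
    by (simp add: eventually_filtermap K_def h_def norm_mean_le PiE_UNIV_domain split: prod.splits)
  ultimately obtain x where x: "inf (nhds x) (filtermap h F) \<noteq> bot"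
    unfolding compact_filter by blast
  \<comment> \<open>The trace of F on the preimages of the neighbourhoods of x, proper because x is
    a cluster point.\<close>
  define G where "G = inf F (filtercomap h (nhds x))"
  have "G \<noteq> bot"
  proof
    assume "G = bot"
    then have "eventually (\<lambda>_. False) G" by simp
    then obtain P Q where PQ: "eventually P F" "eventually Q (nhds x)" "\<And>N. P N \<Longrightarrow> Q (h N) \<Longrightarrow> False"
      unfolding G_def eventually_inf eventually_filtercomap by metis
    have "eventually (\<lambda>y. \<not> Q y) (filtermap h F)"
      unfolding eventually_filtermap using PQ(1) by eventually_elim (use PQ(3) in blast)
    then have "eventually (\<lambda>_. False) (inf (nhds x) (filtermap h F))"
      using PQ(2) unfolding eventually_inf by blast
    then show False using x by (simp add: trivial_limit_def)
  qed
  moreover have "G \<le> F" by (simp add: G_def)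
  moreover have "((\<lambda>N. mean N k v) \<longlongrightarrow> x (k, v)) G" for k v
  proof -
    have lim: "filterlim h (nhds x) G"
      by (rule filterlim_mono[OF filterlim_filtercomap order_refl]) (simp add: G_def)
    have "((\<lambda>N. h N (k, v)) \<longlongrightarrow> x (k, v)) G"
    proof (intro topological_tendstoI)
      fix S assume S: "open S" "x (k, v) \<in> S"
      have "open ((\<lambda>y :: nat \<times> real \<Rightarrow> complex. y (k, v)) -` S)"
        using S(1) by (intro open_vimage continuous_on_product_coordinates)
      then have "eventually (\<lambda>y. y (k, v) \<in> S) (nhds x)"
        unfolding eventually_nhds using S(2) by blast
      then show "eventually (\<lambda>N. h N (k, v) \<in> S) G"
        using lim by (rule eventually_compose_filterlim)
    qed
    then show ?thesis by (simp add: h_def)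
  qed
  ultimately show ?thesis by (intro exI[of _ G] exI[of _ "\<lambda>k v. x (k, v)"]) auto
qed

lemma limit_is_averaging_family:
  assumes G: "G \<noteq> bot" "G \<le> sequentially" and H: "\<And>k v. ((\<lambda>N. mean N k v) \<longlongrightarrow> H k v) G"
  shows "prime_averaging_family H B"
proof
  have pos: "eventually (\<lambda>N. N > 0) G"
    using eventually_gt_at_top[of "0 :: nat"] G(2) by (rule filter_leD[rotated])
  have inv: "((\<lambda>N. c / real N) \<longlongrightarrow> 0) G" for c
    using lim_const_over_n[of c] G(2) by (rule filterlim_mono[OF _ order_refl])
  show "norm (H k v) \<le> B" for k v
    using G(1) tendsto_norm[OF H] by (rule tendsto_upperbound[rotated 2]) (simp_all add: norm_mean_le)
  have lip: "norm (H k v - H k w) \<le> 2 * B * \<bar>v - w\<bar>" if "v \<le> w" for k v w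
  proof (rule tendsto_le[OF G(1)])
    show "((\<lambda>N. 2 * B * \<bar>v - w\<bar> + B * exp v / real N) \<longlongrightarrow> 2 * B * \<bar>v - w\<bar>) G"
      using tendsto_add[OF tendsto_const inv] by simp
    show "((\<lambda>N. norm (mean N k v - mean N k w)) \<longlongrightarrow> norm (H k v - H k w)) G"
      by (intro tendsto_intros H)
    show "eventually (\<lambda>N. norm (mean N k v - mean N k w) \<le> 2 * B * \<bar>v - w\<bar> + B * exp v / real N) G"
      using pos by eventually_elim (rule mean_lipschitz[OF that])
  qed
  show "norm (H k v - H k w) \<le> 2 * B * \<bar>v - w\<bar>" for k v w
    using lip[of v w k] lip[of w v k] by (cases "v \<le> w") (simp_all add: norm_minus_commute abs_minus_commute)
  show "norm (of_real (recip_sum P) * H k v - (\<Sum>p\<in>P. of_real (1 / real p) * H (Suc k) (v + ln (real p))))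
      \<le> B * sqrt (recip_sum P)" if P: "finite P" "\<And>p. p \<in> P \<Longrightarrow> prime p" for P k v
  proof (rule tendsto_le[OF G(1)])
    let ?E = "\<lambda>N p. (\<Sum>j=1..nat \<lfloor>real N * exp (- v)\<rfloor> div p. norm (f N k (p * j) - f N (Suc k) j)) / real N"
    show "((\<lambda>N. norm (of_real (recip_sum P) * mean N k v -
        (\<Sum>p\<in>P. of_real (1 / real p) * mean N (Suc k) (v + ln (real p))))) \<longlongrightarrow>
      norm (of_real (recip_sum P) * H k v - (\<Sum>p\<in>P. of_real (1 / real p) * H (Suc k) (v + ln (real p))))) G"
      by (intro tendsto_intros H)
    have E: "((\<lambda>N. ?E N p) \<longlongrightarrow> 0) G" if "p \<in> P" for p
      by (rule filterlim_mono[OF shift[OF P(2)[OF that]] order_refl G(2)]) simp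
    have "((\<lambda>N. B * sqrt (recip_sum P + 2 * recip_sum P * real (card P) * exp v / real N) +
        exp v * (\<Sum>p\<in>P. ?E N p)) \<longlongrightarrow> B * sqrt (recip_sum P + 0) + exp v * (\<Sum>p\<in>P. 0)) G"
      by (intro tendsto_intros inv E)
    then show "((\<lambda>N. B * sqrt (recip_sum P + 2 * recip_sum P * real (card P) * exp v / real N) +
        exp v * (\<Sum>p\<in>P. ?E N p)) \<longlongrightarrow> B * sqrt (recip_sum P)) G" by simp
    show "eventually (\<lambda>N. norm (of_real (recip_sum P) * mean N k v -
        (\<Sum>p\<in>P. of_real (1 / real p) * mean N (Suc k) (v + ln (real p)))) \<le>
        B * sqrt (recip_sum P + 2 * recip_sum P * real (card P) * exp v / real N) +
        exp v * (\<Sum>p\<in>P. ?E N p)) G"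
      using pos by eventually_elim (rule mean_prime_average[OF P])
  qed
qed

lemma mean_level_independent: "(\<lambda>N. mean N (Suc k) v - mean N k v) \<longlonglongrightarrow> 0"
proof (rule ccontr)
  assume "\<not> ?thesis"
  then obtain \<epsilon> where \<epsilon>: "\<epsilon> > 0"
      "\<not> eventually (\<lambda>N. norm (mean N (Suc k) v - mean N k v) < \<epsilon>) sequentially"
    unfolding tendsto_iff by (auto simp: dist_norm)
  \<comment> \<open>F lives on the N that violate convergence, so along every finer filter the two
    limits stay at distance at least \<epsilon>.\<close>
  define F where "F = inf sequentially (principal {N. norm (mean N (Suc k) v - mean N k v) \<ge> \<epsilon>})"
  have "F \<noteq> bot"
    using \<epsilon>(2) by (simp add: F_def trivial_limit_def eventually_inf_principal not_le)
  then obtain G H where G: "G \<noteq> bot" "G \<le> F" and H: "\<And>k v. ((\<lambda>N. mean N k v) \<longlongrightarrow> H k v) G"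
    using exists_limit_filter by blast
  have "G \<le> sequentially" using G(2) by (simp add: F_def)
  then interpret prime_averaging_family H B
    using limit_is_averaging_family G(1) H by blast
  have "((\<lambda>N. norm (mean N (Suc k) v - mean N k v)) \<longlongrightarrow> norm (H (Suc k) v - H k v)) G"
    by (intro tendsto_intros H)
  moreover have "eventually (\<lambda>N. norm (mean N (Suc k) v - mean N k v) \<ge> \<epsilon>) G"
    using G(2) by (rule filter_leD) (simp add: F_def eventually_inf_principal)
  ultimately have "norm (H (Suc k) v - H k v) \<ge> \<epsilon>" using G(1) tendsto_lowerbound by blast
  then show False using \<epsilon>(1) level_independent by simp
qed

end

section \<open>Application to the number of prime factors\<close>

lemma num_prime_factors_prime_mult:
  assumes "prime p" "n > 0"
  shows "num_prime_factors (p * n) = Suc (num_prime_factors n)"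
proof -
  have "p \<noteq> 0" using assms(1) by auto
  then show ?thesis
    using assms by (simp add: num_prime_factors_def prime_factorization_mult prime_factorization_prime)
qed

lemma largest_prime_factor_ge_1: "largest_prime_factor n \<ge> 1"
proof (cases "n \<le> 1")
  case False
  then have "prime_factors n \<noteq> {}" by (simp add: prime_factorization_empty_iff)
  then have "Max (prime_factors n) \<in> prime_factors n" by (intro Max_in) auto
  then have "prime (Max (prime_factors n))" by (rule in_prime_factors_imp_prime)
  then show ?thesis using False by (simp add: largest_prime_factor_def Suc_le_eq prime_gt_0_nat)
qed (simp add: largest_prime_factor_def)

lemma largest_prime_factor_prime_mult:
  assumes "prime p" "n > 0" "prime q" "q dvd n" "p < q"
  shows "largest_prime_factor (p * n) = largest_prime_factor n"
proof -
  have p: "p > 1" and q: "q > 1" using assms prime_gt_1_nat by blast+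
  have n: "n > 1" using dvd_imp_le[OF assms(4,2)] q by simp
  have "p * n > 1" using p n by (metis less_1_mult)
  have "prime_factors (p * n) = insert p (prime_factors n)"
    using assms p by (simp add: prime_factorization_mult prime_factorization_prime)
  moreover have qn: "q \<in> prime_factors n" using assms by (auto simp: prime_factors_dvd)
  then have "Max (insert p (prime_factors n)) = max p (Max (prime_factors n))"
    by (intro Max_insert) auto
  moreover have "Max (prime_factors n) \<ge> q" using qn by (intro Max_ge) auto
  ultimately have "Max (prime_factors (p * n)) = Max (prime_factors n)"
    using assms(5) by simp
  then show ?thesis using n \<open>p * n > 1\<close> by (simp add: largest_prime_factor_def)
qed

lemma psi_prime_mult:
  assumes "prime p" "n > 0"
  shows "psi N (p * n) = psi N n + 1 / sqrt (ln (ln (real N)))"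
  using num_prime_factors_prime_mult[OF assms] by (simp add: psi_def diff_divide_distrib add_divide_distrib)

lemma compact_support_uniformly_continuous:
  fixes F :: "real \<Rightarrow> complex"
  assumes F: "continuous_on UNIV F" and supp: "compact (closure {x. F x \<noteq> 0})"
  shows "uniformly_continuous_on UNIV F" and "bounded (range F)"
proof -
  obtain R where R: "\<And>x. F x \<noteq> 0 \<Longrightarrow> \<bar>x\<bar> \<le> R"
    using bounded_subset[OF compact_imp_bounded[OF supp] closure_subset]
    unfolding bounded_iff real_norm_def by blast
  \<comment> \<open>The margin 1 matches \<open>min d 1\<close> below: if one of two close points
    leaves K, both lie outside [-R, R], where F vanishes.\<close>
  define K where "K = {-(R + 1)..R + 1}"
  have K: "compact K" by (simp add: K_def)
  have contK: "continuous_on K F" using F by (rule continuous_on_subset) auto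
  have "range F \<subseteq> insert 0 (F ` K)"
  proof
    fix y assume "y \<in> range F"
    then obtain x where "y = F x" by blast
    then show "y \<in> insert 0 (F ` K)" using R[of x] by (cases "F x = 0") (auto simp: K_def abs_le_iff)
  qed
  moreover have "bounded (insert 0 (F ` K))"
    using compact_imp_bounded[OF compact_continuous_image[OF contK K]] by simp
  ultimately show "bounded (range F)" by (rule bounded_subset[rotated])
  show "uniformly_continuous_on UNIV F"
    unfolding uniformly_continuous_on_def
  proof (intro allI impI)
    fix e :: real assume e: "e > 0"
    obtain d where d: "d > 0" "\<And>x y. x \<in> K \<Longrightarrow> y \<in> K \<Longrightarrow> dist y x < d \<Longrightarrow> dist (F y) (F x) < e"
      using compact_uniformly_continuous[OF contK K] e unfolding uniformly_continuous_on_def by blast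
    have "dist (F y) (F x) < e" if xy: "dist y x < min d 1" for x y
    proof (cases "x \<in> K \<and> y \<in> K")
      case False
      then have "\<not> \<bar>x\<bar> \<le> R \<and> \<not> \<bar>y\<bar> \<le> R"
        using xy unfolding K_def dist_real_def by auto
      then have "F x = 0" "F y = 0" using R by blast+
      then show ?thesis using e by simp
    qed (use d xy in auto)
    then show "\<exists>d>0. \<forall>x\<in>UNIV. \<forall>y\<in>UNIV. dist y x < d \<longrightarrow> dist (F y) (F x) < e"
      using d(1) by (intro exI[of _ "min d 1"]) auto
  qed
qed

lemma exists_large_recip_sum: "\<exists>Q. finite Q \<and> (\<forall>q\<in>Q. prime q \<and> q > p) \<and> recip_sum Q \<ge> W"
proof -
  obtain h \<rho> where rob: "robust_log_gap h 1 \<rho>"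
    using exists_robust_log_gap[of 1] by (meson zero_less_one)
  obtain P where P: "finite P" "\<And>p. p \<in> P \<Longrightarrow> prime p" "recip_sum P \<ge> W + recip_sum {..p}"
    using rob[unfolded robust_log_gap_def, THEN spec, of "W + recip_sum {..p}"] by blast
  have "recip_sum P \<le> recip_sum ((P - {..p}) \<union> {..p})"
    using P(1) by (intro recip_sum_mono) auto
  also have "\<dots> \<le> recip_sum (P - {..p}) + recip_sum {..p}"
    using P(1) by (intro recip_sum_Un_le) auto
  finally have "recip_sum (P - {..p}) \<ge> W" using P(3) by linarith
  then show ?thesis using P by (intro exI[of _ "P - {..p}"]) auto
qed

text \<open>Passing from j to p j matches the argument of \<open>a\<close> exactly once k is raised.
  The argument of \<open>F2\<close> moves by 1 / sqrt (ln (ln N)), which uniform continuity absorbs.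
  P^+ is unchanged once j has a prime factor in a finite set Q of primes above p, and the j without
  one have density O(1 / \<open>recip_sum Q\<close>).\<close>

lemma sequence_shift_compatible:
  fixes F1 :: "nat \<Rightarrow> complex" and F2 :: "real \<Rightarrow> complex" and a :: "nat \<Rightarrow> complex"
  assumes F1: "\<And>n. n \<ge> 1 \<Longrightarrow> norm (F1 n) \<le> B1" and F2: "\<And>x. norm (F2 x) \<le> B2" "uniformly_continuous_on UNIV F2"
    and a: "\<And>n. norm (a n) \<le> B3"
  shows "shift_compatible (\<lambda>N k n. F1 (largest_prime_factor n) * F2 (psi N n) * a (num_prime_factors n + k)) (B1 * B2 * B3)"
proof
  define f where "f N k n = F1 (largest_prime_factor n) * F2 (psi N n) * a (num_prime_factors n + k)" for N k n
  have B: "B1 \<ge> 0" "B2 \<ge> 0" "B3 \<ge> 0"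
    using F1[of 1] F2(1)[of 0] a[of 0] norm_ge_zero order_trans by blast+
  have norm_f: "norm (f N k n) \<le> B1 * B2 * B3" for N k n
    unfolding f_def norm_mult using B F1[OF largest_prime_factor_ge_1] F2 a by (intro mult_mono) auto
  then show "norm (F1 (largest_prime_factor n) * F2 (psi N n) * a (num_prime_factors n + k)) \<le> B1 * B2 * B3"
    for N k n by (simp add: f_def)
  have "(\<lambda>N. (\<Sum>j=1..nat \<lfloor>real N * c\<rfloor> div p. norm (f N k (p * j) - f N (Suc k) j)) / real N) \<longlonglongrightarrow> 0"
    if p: "prime p" and c: "c > 0" for p c k
  proof (rule tendstoI)
    fix \<epsilon> :: real assume \<epsilon>: "\<epsilon> > 0"
    \<comment> \<open>D collects the factor 2 c from counting the exceptional j and the trivial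
      bound 2 B1 B2 B3; the choices of \<eta> and Q then make each error at most
      \<epsilon>/4.\<close>
    define D where "D = 4 * c * (B1 * B2 * B3)"
    define \<eta> where "\<eta> = \<epsilon> / (4 * (c * (B1 * B3) + 1))"
    have D: "D \<ge> 0" using B c by (simp add: D_def)
    have cB: "c * (B1 * B3) \<ge> 0" using B c by simp
    then have \<eta>: "\<eta> > 0" using \<epsilon> by (simp add: \<eta>_def)
    obtain d where d: "d > 0" "\<And>x y. dist y x < d \<Longrightarrow> dist (F2 y) (F2 x) < \<eta>"
      using F2(2)[unfolded uniformly_continuous_on_def, THEN spec, THEN mp, OF \<eta>] by blast
    obtain Q where Q: "finite Q" "\<And>q. q \<in> Q \<Longrightarrow> prime q" "\<And>q. q \<in> Q \<Longrightarrow> q > p"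
        "recip_sum Q \<ge> 4 * (D + 1) / \<epsilon>"
      using exists_large_recip_sum[of p "4 * (D + 1) / \<epsilon>"] by blast
    have "4 * (D + 1) / \<epsilon> > 0" using D \<epsilon> by simp
    then have W: "recip_sum Q > 0" using Q(4) by linarith
    have "(\<lambda>N. 1 / sqrt (ln (ln (real N)))) \<longlonglongrightarrow> 0" by real_asymp
    then have ev1: "\<forall>\<^sub>F N in sequentially. \<bar>1 / sqrt (ln (ln (real N)))\<bar> < d"
      using d(1) unfolding tendsto_iff dist_real_def by simp
    have ev2: "\<forall>\<^sub>F N in sequentially. 2 * real (card Q) / real N < c"
      using order_tendstoD(2)[OF lim_const_over_n[of "2 * real (card Q)"] c] .
    show "\<forall>\<^sub>F N in sequentially.
        dist ((\<Sum>j=1..nat \<lfloor>real N * c\<rfloor> div p. norm (f N k (p * j) - f N (Suc k) j)) / real N) 0 < \<epsilon>"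
      using ev1 ev2 eventually_gt_at_top[of 0]
    proof eventually_elim
      case (elim N)
      define M where "M = nat \<lfloor>real N * c\<rfloor> div p"
      define A where "A = {j \<in> {1..M}. \<forall>q\<in>Q. \<not> q dvd j}"
      have N: "real N > 0" using elim by simp
      have "real (nat \<lfloor>real N * c\<rfloor>) \<le> real N * c" using c by simp
      moreover have "M \<le> nat \<lfloor>real N * c\<rfloor>" by (simp add: M_def)
      ultimately have M: "real M \<le> real N * c" by linarith
      have term_le: "norm (f N k (p * j) - f N (Suc k) j) \<le> (if j \<in> A then 2 * (B1 * B2 * B3) else 0) + B1 * B3 * \<eta>"
        if j: "j \<in> {1..M}" for j
      proof (cases "j \<in> A")
        case True
        have "norm (f N k (p * j) - f N (Suc k) j) \<le> B1 * B2 * B3 + B1 * B2 * B3"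
          by (intro order_trans[OF norm_triangle_ineq4] add_mono norm_f)
        moreover have "B1 * B3 * \<eta> \<ge> 0" using B \<eta> by simp
        ultimately show ?thesis using True by simp
      next
        case False
        then obtain q where q: "q \<in> Q" "q dvd j" using j by (auto simp: A_def)
        have j0: "j > 0" using j by simp
        have "largest_prime_factor (p * j) = largest_prime_factor j"
          using p j0 q Q by (intro largest_prime_factor_prime_mult) auto
        then have "f N k (p * j) - f N (Suc k) j =
            F1 (largest_prime_factor j) * (F2 (psi N (p * j)) - F2 (psi N j)) * a (num_prime_factors j + Suc k)"
          using num_prime_factors_prime_mult[OF p j0] by (simp add: f_def algebra_simps)
        also have "norm \<dots> \<le> B1 * \<eta> * B3"
          unfolding norm_mult
        proof (intro mult_mono)
          have "dist (psi N (p * j)) (psi N j) < d"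
            using elim(1) by (simp add: psi_prime_mult[OF p j0] dist_real_def)
          then show "norm (F2 (psi N (p * j)) - F2 (psi N j)) \<le> \<eta>"
            using d(2) by (simp add: dist_norm less_imp_le)
        qed (use B \<eta> F1[OF largest_prime_factor_ge_1] a in auto)
        finally show ?thesis using False by (simp add: mult_ac)
      qed
      have "(\<Sum>j=1..M. norm (f N k (p * j) - f N (Suc k) j)) \<le>
          (\<Sum>j=1..M. (if j \<in> A then 2 * (B1 * B2 * B3) else 0) + B1 * B3 * \<eta>)"
        using term_le by (intro sum_mono)
      also have "\<dots> = (\<Sum>j=1..M. if j \<in> A then 2 * (B1 * B2 * B3) else 0) + real M * (B1 * B3 * \<eta>)"
        by (simp add: sum.distrib)
      also have "(\<Sum>j=1..M. if j \<in> A then 2 * (B1 * B2 * B3) else 0) = (\<Sum>j\<in>A. 2 * (B1 * B2 * B3))"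
        by (intro sum.mono_neutral_cong_right) (auto simp: A_def)
      also have "\<dots> = real (card A) * (2 * (B1 * B2 * B3))" by simp
      finally have "(\<Sum>j=1..M. norm (f N k (p * j) - f N (Suc k) j)) \<le>
          real (card A) * (2 * (B1 * B2 * B3)) + real M * (B1 * B3 * \<eta>)" .
      also have "real (card A) * (2 * (B1 * B2 * B3)) \<le> (2 * c * real N) / recip_sum Q * (2 * (B1 * B2 * B3))"
      proof (intro mult_right_mono)
        have "real (card A) \<le> (real M + 2 * real (card Q)) / recip_sum Q"
          unfolding A_def using Q W by (intro card_coprime_to_primes_le) auto
        moreover have "2 * real (card Q) \<le> c * real N" using elim(2) N by (simp add: field_simps)
        then have "real M + 2 * real (card Q) \<le> 2 * c * real N" using M by (simp add: algebra_simps)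
        then have "(real M + 2 * real (card Q)) / recip_sum Q \<le> (2 * c * real N) / recip_sum Q"
          using W by (intro divide_right_mono) auto
        ultimately show "real (card A) \<le> (2 * c * real N) / recip_sum Q" by linarith
      qed (use B in simp)
      finally have "(\<Sum>j=1..M. norm (f N k (p * j) - f N (Suc k) j)) \<le>
          (2 * c * real N) / recip_sum Q * (2 * (B1 * B2 * B3)) + real M * (B1 * B3 * \<eta>)" by simp
      also have "\<dots> \<le> D / recip_sum Q * real N + (c * (B1 * B3) * \<eta>) * real N"
      proof (intro add_mono)
        show "(2 * c * real N) / recip_sum Q * (2 * (B1 * B2 * B3)) \<le> D / recip_sum Q * real N"
          by (simp add: D_def mult_ac)
        have "real M * (B1 * B3 * \<eta>) \<le> (real N * c) * (B1 * B3 * \<eta>)"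
          using M B \<eta> by (intro mult_right_mono) auto
        then show "real M * (B1 * B3 * \<eta>) \<le> (c * (B1 * B3) * \<eta>) * real N" by (simp add: mult_ac)
      qed
      finally have "(\<Sum>j=1..M. norm (f N k (p * j) - f N (Suc k) j)) / real N \<le>
          D / recip_sum Q + c * (B1 * B3) * \<eta>"
        using N by (simp add: pos_divide_le_eq algebra_simps)
      moreover have "D / recip_sum Q \<le> \<epsilon> / 4"
      proof -
        have "4 * (D + 1) \<le> \<epsilon> * recip_sum Q" using Q(4) \<epsilon> by (simp add: pos_divide_le_eq mult.commute)
        then have "D \<le> \<epsilon> / 4 * recip_sum Q" by simp
        then show ?thesis using W by (simp add: pos_divide_le_eq)
      qed
      moreover have "c * (B1 * B3) * \<eta> \<le> \<epsilon> / 4"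
      proof -
        have "c * (B1 * B3) * \<eta> \<le> (c * (B1 * B3) + 1) * \<eta>" using \<eta> by (intro mult_right_mono) auto
        also have "\<dots> = \<epsilon> / 4"
        proof -
          have "x * (\<epsilon> / (4 * x)) = \<epsilon> / 4" if "x \<noteq> 0" for x using that by simp
          moreover have "c * (B1 * B3) + 1 \<noteq> 0" using cB by linarith
          ultimately show ?thesis unfolding \<eta>_def by blast
        qed
        finally show ?thesis .
      qed
      moreover have "(\<Sum>j=1..M. norm (f N k (p * j) - f N (Suc k) j)) / real N \<ge> 0"
        by (intro divide_nonneg_nonneg sum_nonneg) auto
      ultimately show ?case using \<epsilon> unfolding M_def[symmetric] dist_real_def by linarith
    qed
  qed
  then show "(\<lambda>N. (\<Sum>j=1..nat \<lfloor>real N * c\<rfloor> div p. norm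
        (F1 (largest_prime_factor (p * j)) * F2 (psi N (p * j)) * a (num_prime_factors (p * j) + k) -
         F1 (largest_prime_factor j) * F2 (psi N j) * a (num_prime_factors j + Suc k))) / real N) \<longlonglongrightarrow> 0"
    if "prime p" "c > 0" for p c k
    using that by (simp add: f_def)
qed

theorem theorem14:
  fixes F1 :: "nat \<Rightarrow> complex" and F2 :: "real \<Rightarrow> complex" and a :: "nat \<Rightarrow> complex"
  assumes "bounded (F1 ` {1..})"
    and "continuous_on UNIV F2"
    and "compact (closure {x. F2 x \<noteq> 0})"
    and "bounded (range a)"
  shows "(\<lambda>N::nat.
      1 / of_nat N * (\<Sum>n=1..N.
        F1 (largest_prime_factor n) * F2 (psi N n) * a (num_prime_factors n + 1))
    - 1 / of_nat N * (\<Sum>n=1..N.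
        F1 (largest_prime_factor n) * F2 (psi N n) * a (num_prime_factors n)))
    \<in> o(\<lambda>_. 1)"
proof -
  obtain B1 where B1: "\<And>n. n \<ge> 1 \<Longrightarrow> norm (F1 n) \<le> B1"
    using assms(1) unfolding bounded_iff by auto
  obtain B2 where B2: "\<And>x. norm (F2 x) \<le> B2"
    using compact_support_uniformly_continuous(2)[OF assms(2,3)] unfolding bounded_iff by auto
  obtain B3 where B3: "\<And>n. norm (a n) \<le> B3"
    using assms(4) unfolding bounded_iff by auto
  define f where "f N k n = F1 (largest_prime_factor n) * F2 (psi N n) * a (num_prime_factors n + k)" for N k n
  interpret shift_compatible f "B1 * B2 * B3"
    unfolding f_def[abs_def]
    by (intro sequence_shift_compatible B1 B2 B3 compact_support_uniformly_continuous(1) assms)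
  \<comment> \<open>At v = 0 the cutoff is N itself and the normalisation 1/N, so levels 1 and 0 are
    the two averages to be compared.\<close>
  have "(\<lambda>N. mean N (Suc 0) 0 - mean N 0 0) \<longlonglongrightarrow> 0" by (rule mean_level_independent)
  then show ?thesis
    by (intro smalloI_tendsto) (simp_all add: mean_def f_def)
qed

end
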